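(* There is an algorithm that, given a tree $T$ of order $n$, enumerates all globally minimal defensive alliances of $T$ in total time $\mathcal{O}^*\left(\sqrt{2}^{\,n}\right)$ and with polynomial delay.
   Context: Graphs are finite, simple and undirected. For $G=(V,E)$, $X\subseteq V$ and $v\in V$, $\deg_X(v)$ is the number of neighbors of $v$ in $X$, and $\overline{X}=V\setminus X$. A set $A\subseteq V$ is a defensive alliance if $\deg_A(v)+1\ge \deg_{\overline{A}}(v)$ for every $v\in A$. A non-empty defensive alliance is globally minimal if no proper subset of it is a non-empty defensive alliance. $\mathcal{O}^*$ suppresses factors polynomial in $n$. An enumeration algorithm (which outputs every solution exactly once) has polynomial delay if the time before the first output, between any two consecutive outputs, and between the last output and termination is bounded by a polynomial in the input size. *)

theory Defs
  imports
    Complex_Main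
    "HOL-Computational_Algebra.Polynomial"
    "HOL-Library.Landau_Symbols"
begin

section \<open>Graphs and trees\<close>

text \<open>
  An undirected graph is a vertex set together with a set of two-element edges. The notion of
  tree in Graph_Theory is not usable here: that entry treats an undirected graph as a symmetric
  digraph, and in such a digraph the walk \<open>u, v, u\<close> counts as a cycle.
\<close>

definition simple_graph :: "'a set \<Rightarrow> 'a set set \<Rightarrow> bool" where
  "simple_graph V E \<longleftrightarrow> finite V \<and> (\<forall>e\<in>E. e \<subseteq> V \<and> card e = 2)"

definition graph_connected :: "'a set \<Rightarrow> 'a set set \<Rightarrow> bool" where
  "graph_connected V E \<longleftrightarrow> V \<noteq> {} \<and> (\<forall>u\<in>V. \<forall>v\<in>V. (u, v) \<in> {(x, y). {x, y} \<in> E}\<^sup>*)"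

definition graph_cycle :: "'a set set \<Rightarrow> 'a list \<Rightarrow> bool" where
  "graph_cycle E xs \<longleftrightarrow> length xs \<ge> 3 \<and> distinct xs \<and>
     (\<forall>i<length xs. {xs ! i, xs ! (Suc i mod length xs)} \<in> E)"

definition is_tree :: "'a set \<Rightarrow> 'a set set \<Rightarrow> bool" where
  "is_tree V E \<longleftrightarrow> simple_graph V E \<and> graph_connected V E \<and> (\<nexists>xs. graph_cycle E xs)"


section \<open>Defensive alliances\<close>

definition deg_in :: "'a set set \<Rightarrow> 'a set \<Rightarrow> 'a \<Rightarrow> nat" where
  "deg_in E X v = card {u \<in> X. {v, u} \<in> E}"

definition defensive_alliance :: "'a set \<Rightarrow> 'a set set \<Rightarrow> 'a set \<Rightarrow> bool" where
  "defensive_alliance V E A \<longleftrightarrow> A \<subseteq> V \<and> (\<forall>v\<in>A. deg_in E A v + 1 \<ge> deg_in E (V - A) v)"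

definition globally_minimal_defensive_alliance :: "'a set \<Rightarrow> 'a set set \<Rightarrow> 'a set \<Rightarrow> bool" where
  "globally_minimal_defensive_alliance V E A \<longleftrightarrow>
     A \<noteq> {} \<and> defensive_alliance V E A \<and>
     (\<nexists>B. B \<subset> A \<and> B \<noteq> {} \<and> defensive_alliance V E B)"


section \<open>A machine model with output\<close>

text \<open>
  Algorithms are programs of a structured random access machine. The memory consists of named
  two-dimensional arrays of natural numbers, all indices being computed at run time; entry
  \<open>(0, 0)\<close> of an array serves as a scalar variable.

  Every elementary command, and every evaluation of a test, takes one step. This uniform cost
  measure is sound because increment and decrement are the only arithmetic operations: a program
  contains only finitely many expressions, so after \<open>t\<close> steps no value and no address exceeds
  the largest input number by more than \<open>O(t + 1)\<close>, and numbers remain of bit length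
  \<open>O(n)\<close> even in runs of length \<open>2\<close> to the power \<open>O(n)\<close>. (With addition as a unit-cost
  operation, values could instead double in each step.)
\<close>

type_synonym memory = "nat \<Rightarrow> nat \<Rightarrow> nat \<Rightarrow> nat"

datatype aexp = Const nat | Entry nat aexp aexp | Inc aexp | Dec aexp

datatype bexp = Less aexp aexp | Equal aexp aexp | Neg bexp | Conj bexp bexp

datatype com =
    Skip
  | Assign nat aexp aexp aexp  \<comment> \<open>\<open>Assign a i j e\<close> stores \<open>e\<close> in entry \<open>(i, j)\<close> of array \<open>a\<close>\<close>
  | Write aexp  \<comment> \<open>adds an element to the set that is currently being output\<close>
  | Emit  \<comment> \<open>completes the current output\<close>
  | Seq com com
  | IfElse bexp com com
  | While bexp com

primrec aval :: "aexp \<Rightarrow> memory \<Rightarrow> nat" where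
  "aval (Const k) m = k"
| "aval (Entry a i j) m = m a (aval i m) (aval j m)"
| "aval (Inc e) m = aval e m + 1"
| "aval (Dec e) m = aval e m - 1"

primrec bval :: "bexp \<Rightarrow> memory \<Rightarrow> bool" where
  "bval (Less e f) m \<longleftrightarrow> aval e m < aval f m"
| "bval (Equal e f) m \<longleftrightarrow> aval e m = aval f m"
| "bval (Neg b) m \<longleftrightarrow> \<not> bval b m"
| "bval (Conj b c) m \<longleftrightarrow> bval b m \<and> bval c m"

definition update :: "memory \<Rightarrow> nat \<Rightarrow> nat \<Rightarrow> nat \<Rightarrow> nat \<Rightarrow> memory" where
  "update m a i j x = m(a := (m a)(i := (m a i)(j := x)))"

text \<open>
  \<open>exec c m tr m'\<close>: started in memory \<open>m\<close>, the program \<open>c\<close> terminates in memory \<open>m'\<close>, and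
  \<open>tr\<close> lists the steps of the run, one event per step. The running time is \<open>length tr\<close>.
\<close>

datatype event = Tick | Written nat | Emitted

inductive exec :: "com \<Rightarrow> memory \<Rightarrow> event list \<Rightarrow> memory \<Rightarrow> bool" where
  Skip: "exec Skip m [Tick] m"
| Assign: "exec (Assign a i j e) m [Tick] (update m a (aval i m) (aval j m) (aval e m))"
| Write: "exec (Write e) m [Written (aval e m)] m"
| Emit: "exec Emit m [Emitted] m"
| Seq: "exec c m tr m' \<Longrightarrow> exec d m' tr' m'' \<Longrightarrow> exec (Seq c d) m (tr @ tr') m''"
| IfTrue: "bval b m \<Longrightarrow> exec c m tr m' \<Longrightarrow> exec (IfElse b c d) m (Tick # tr) m'"
| IfFalse: "\<not> bval b m \<Longrightarrow> exec d m tr m' \<Longrightarrow> exec (IfElse b c d) m (Tick # tr) m'"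
| WhileFalse: "\<not> bval b m \<Longrightarrow> exec (While b c) m [Tick] m"
| WhileTrue: "bval b m \<Longrightarrow> exec c m tr m' \<Longrightarrow> exec (While b c) m' tr' m'' \<Longrightarrow>
    exec (While b c) m (Tick # tr @ tr') m''"

lemma exec_deterministic:
  assumes "exec c m tr m'" "exec c m tr2 m2"
  shows "tr = tr2 \<and> m' = m2"
  using assms
proof (induction arbitrary: tr2 m2 rule: exec.induct)
  case (Seq c m tr m' d tr' m'')
  from Seq.prems obtain ta ma tb where "tr2 = ta @ tb" "exec c m ta ma" "exec d ma tb m2"
    by cases
  with Seq.IH show ?case by metis
next
  case (IfTrue b m c tr m' d)
  from IfTrue.prems IfTrue.hyps(1) obtain ta where "tr2 = Tick # ta" "exec c m ta m2"
    by cases simp_all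
  with IfTrue.IH show ?case by metis
next
  case (IfFalse b m d tr m' c)
  from IfFalse.prems IfFalse.hyps(1) obtain ta where "tr2 = Tick # ta" "exec d m ta m2"
    by cases simp_all
  with IfFalse.IH show ?case by metis
next
  case (WhileFalse b m c)
  from WhileFalse.prems WhileFalse.hyps(1) show ?case by cases simp_all
next
  case (WhileTrue b m c tr m' tr' m'')
  from WhileTrue.prems WhileTrue.hyps(1)
  obtain ta ma tb where "tr2 = Tick # ta @ tb" "exec c m ta ma" "exec (While b c) ma tb m2"
    by cases simp_all
  with WhileTrue.IH show ?case by metis
qed (auto elim: exec.cases)


section \<open>Enumeration, delay and total time\<close>

text \<open>
  \<open>blocks\<close> cuts a run after each completed output. Hence the first block is the time up to the
  first output, the last one (which may be empty) is the time between the last output and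
  termination, and the others are the times between consecutive outputs.
\<close>

fun blocks :: "event list \<Rightarrow> event list list" where
  "blocks [] = [[]]"
| "blocks (Emitted # tr) = [Emitted] # blocks tr"
| "blocks (ev # tr) = (ev # hd (blocks tr)) # tl (blocks tr)"

lemma blocks_nonempty: "blocks tr \<noteq> []"
  by (induction tr rule: blocks.induct) auto

lemma concat_blocks: "concat (blocks tr) = tr"
proof (induction tr)
  case (Cons ev tr)
  then show ?case using blocks_nonempty[of tr] by (cases ev; cases "blocks tr") auto
qed simp

definition outputs :: "event list \<Rightarrow> nat set list" where
  "outputs tr = map (\<lambda>b. {x. Written x \<in> set b}) (butlast (blocks tr))"

definition delays :: "event list \<Rightarrow> nat list" where
  "delays tr = map length (blocks tr)"

text \<open>
  A graph with vertex set \<open>{..<n}\<close> is given by its order, in scalar \<open>0\<close>, and its adjacency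
  matrix, in array \<open>1\<close>. All other entries are initially \<open>0\<close>. The size of this input is
  polynomial in \<open>n\<close> and at least \<open>n\<close>, so polynomial bounds may be expressed in terms of \<open>n\<close>.
\<close>

definition graph_input :: "nat \<Rightarrow> nat set set \<Rightarrow> memory" where
  "graph_input n E = (\<lambda>a i j.
     if a = 0 \<and> i = 0 \<and> j = 0 then n
     else if a = 1 \<and> {i, j} \<in> E then 1
     else 0)"

definition O_star :: "(nat \<Rightarrow> real) \<Rightarrow> (nat \<Rightarrow> real) set" where
  "O_star g = (\<Union>p::real poly. O(\<lambda>n. poly p (real n) * g n))"

text \<open>
  The program \<open>c\<close>, run on the input \<open>m\<close>, terminates, outputs every member of \<open>S\<close> exactly
  once and nothing else, takes total time at most \<open>T\<close>, and has delay at most \<open>D\<close>.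
\<close>

definition enumerates_within :: "com \<Rightarrow> memory \<Rightarrow> nat set set \<Rightarrow> real \<Rightarrow> nat \<Rightarrow> bool" where
  "enumerates_within c m S T D \<longleftrightarrow> (\<exists>tr m'. exec c m tr m' \<and>
     distinct (outputs tr) \<and> set (outputs tr) = S \<and>
     real (length tr) \<le> T \<and> (\<forall>d\<in>set (delays tr). d \<le> D))"

end

theory Submission
  imports Defs
begin

text \<open>
  In a tree, the globally minimal defensive alliances are the non-empty connected sets \<open>A\<close> in
  which every vertex \<open>v\<close> has exactly \<open>deg v div 2\<close> neighbours. Root the tree and number the
  vertices by positions such that parents precede children; then \<open>A\<close> has exactly one member (its
  top) without parent in \<open>A\<close>, and the number of children in \<open>A\<close> of each member is prescribed.

  Whether a choice among the first \<open>k\<close> positions extends to such a set can be decided locally,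
  by comparing, for each chosen vertex, the prescribed number with the number of children already
  chosen and the number of children still available. Deciding the positions one after the other
  with this test never runs into a dead end, which gives polynomial delay.

  Since the number of children in \<open>A\<close> is prescribed, \<open>A\<close> is determined by its top and its
  members that are neither leaves nor the last child of their parent. The map from a
  vertex to its last child shows that at most \<open>n div 2\<close> vertices are of this kind. So there are at
  most \<open>n * 2 ^ (n div 2)\<close> solutions, and the total time follows from the delay.
\<close>

section \<open>Solutions in a rooted tree\<close>

text \<open>Exactness comes from cutting edges. A set is an alliance iff each member
  \<open>v\<close> has at least \<open>deg v div 2\<close> neighbours inside. In a tree, deleting an
  edge inside a connected set separates it into two pieces and costs only the two ends of this edge
  a neighbour, one each. So a member with a surplus gives a smaller alliance, namely the piece on
  its side of an edge to a neighbour. Conversely, if no member has a surplus, every proper non-empty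
  part of a connected set has a member at a boundary edge, and this member drops below the
  threshold. A local test suffices because the subtrees below different children are disjoint and
  impose no conditions on each other: only the number of usable children of a vertex matters. A
  count of solutions does not bound the delay, and a delay does not give the base
  \<open>sqrt 2\<close>. The two bounds are independent; they are combined through the number of
  blocks of a run, which exceeds the number of outputs by one.\<close>

locale rooted_tree =
  fixes n :: nat and par :: "nat \<Rightarrow> nat"
  assumes n_pos: "0 < n"
    and par_root: "par 0 = n"
    and par_less: "\<And>i. 0 < i \<Longrightarrow> i < n \<Longrightarrow> par i < i"
begin

definition children :: "nat \<Rightarrow> nat set" where
  "children v = {c. c < n \<and> par c = v}"

definition half :: "nat \<Rightarrow> nat" where
  "half v = (card (children v) + (if v = 0 then 0 else 1)) div 2"

definition tree_edges :: "nat set set" where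
  "tree_edges = (\<lambda>i. {i, par i}) ` {0<..<n}"

lemma finite_children [simp]: "finite (children v)"
  by (simp add: children_def)

lemma par_cases: "v < n \<Longrightarrow> par v < v \<or> v = 0 \<and> par v = n"
  using par_root par_less[of v] by (cases "v = 0") auto

lemma par_ne: "v < n \<Longrightarrow> par v \<noteq> v"
  using par_cases[of v] by auto

lemma children_greater: "v < n \<Longrightarrow> c \<in> children v \<Longrightarrow> v < c"
  using par_cases[of c] by (auto simp: children_def)

text \<open>
  A vertex is feasible if it can be a member of a solution together with its parent, and
  startable if it can be the top of a solution.
\<close>

inductive feasible :: "nat \<Rightarrow> bool" where
  "v < n \<Longrightarrow> 0 < half v \<Longrightarrow> S \<subseteq> children v \<Longrightarrow> half v \<le> Suc (card S) \<Longrightarrow> \<forall>c\<in>S. feasible c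
    \<Longrightarrow> feasible v"

text \<open>The rule asks for some witness set \<open>S\<close>, which makes its premises visibly
  monotone in \<open>feasible\<close>. Taking all feasible children as the witness gives a recursive
  equation. The \<open>Suc\<close> stands for the parent, which is a neighbour too.\<close>

lemma feasible_iff:
  assumes "v < n"
  shows "feasible v \<longleftrightarrow> 0 < half v \<and> half v \<le> Suc (card {c \<in> children v. feasible c})"
proof
  assume "feasible v"
  then show "0 < half v \<and> half v \<le> Suc (card {c \<in> children v. feasible c})"
  proof cases
    case (1 S)
    then have "card S \<le> card {c \<in> children v. feasible c}"
      by (intro card_mono) auto
    then show ?thesis using 1 by simp
  qed
next
  assume "0 < half v \<and> half v \<le> Suc (card {c \<in> children v. feasible c})"
  then show "feasible v"
    using assms by (intro feasible.intros[of v "{c \<in> children v. feasible c}"]) auto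
qed

definition startable :: "nat \<Rightarrow> bool" where
  "startable v \<longleftrightarrow> half v \<le> card {c \<in> children v. feasible c}"

section \<open>Local test for prefixes of choices\<close>

definition placed :: "nat \<Rightarrow> nat set \<Rightarrow> nat \<Rightarrow> nat set" where
  "placed k X v = {c \<in> children v. c < k \<and> c \<in> X}"

definition available :: "nat \<Rightarrow> nat set \<Rightarrow> nat \<Rightarrow> nat set" where
  "available k X v = {c \<in> children v. if c < k then c \<in> X else feasible c}"

text \<open>The root needs no special case: \<open>par 0 = n\<close> never lies in a set of
  vertices. At \<open>k = n\<close>, having at most one top expresses connectedness.\<close>

definition tops :: "nat \<Rightarrow> nat set \<Rightarrow> nat set" where
  "tops k X = {v. v < k \<and> v \<in> X \<and> par v \<notin> X}"

text \<open>The number of children still to be reached is \<open>half v - 1\<close> or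
  \<open>half v\<close>, depending on the parent; it must lie between those placed and those
  available. The strict inequality avoids truncated subtraction and excludes
  \<open>half v = 0\<close> below a chosen parent.\<close>

definition locally_good :: "nat \<Rightarrow> nat set \<Rightarrow> nat \<Rightarrow> bool" where
  "locally_good k X v \<longleftrightarrow>
     (if par v \<in> X
      then card (placed k X v) < half v \<and> half v \<le> Suc (card (available k X v))
      else card (placed k X v) \<le> half v \<and> half v \<le> card (available k X v))"

text \<open>The last conjunct accounts for non-emptiness: a prefix without members survives only as
  long as some later position can become the top.\<close>

definition good :: "nat \<Rightarrow> nat set \<Rightarrow> bool" where
  "good k X \<longleftrightarrow> (\<forall>v<k. v \<in> X \<longrightarrow> locally_good k X v) \<and> card (tops k X) \<le> 1 \<and>
     ((\<exists>v<k. v \<in> X) \<or> (\<exists>r<n. k \<le> r \<and> startable r))"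

lemma finite_sets [simp]:
  "finite (placed k X v)" "finite (available k X v)" "finite (tops k X)"
  by (simp_all add: placed_def available_def tops_def)

text \<open>Only positions below \<open>k\<close> are read, because the parent of such a position is
  smaller or the sentinel \<open>n\<close>.\<close>

lemma good_cong:
  assumes "X \<inter> {..<k} = Y \<inter> {..<k}" "n \<notin> X" "n \<notin> Y" "k \<le> n"
  shows "good k X \<longleftrightarrow> good k Y"
proof -
  have mem: "c \<in> X \<longleftrightarrow> c \<in> Y" if "c < k" for c
    using assms(1) that by blast
  have par: "par v \<in> X \<longleftrightarrow> par v \<in> Y" if "v < k" for v
    using par_cases[of v] that assms(2-4) mem[of "par v"] by auto
  have "placed k X = placed k Y" "available k X = available k Y"
    using mem by (auto simp: placed_def available_def fun_eq_iff)
  moreover have "tops k X = tops k Y"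
    using mem par by (auto simp: tops_def)
  ultimately show ?thesis
    using mem par by (auto simp: good_def locally_good_def)
qed

text \<open>Position \<open>n - 1\<close> has no children, so its degree is at most one, its quota
  is 0, and it can form a solution alone.\<close>

lemma good_0: "good 0 {}"
proof -
  have "children (n - 1) = {}"
    using children_greater[of "n - 1"] n_pos by (fastforce simp: children_def)
  then have "startable (n - 1)"
    by (simp add: startable_def half_def)
  then show ?thesis
    using n_pos by (auto simp: good_def tops_def intro!: exI[of _ "n - 1"])
qed

lemma available_new: "k < n \<Longrightarrow> available (Suc k) X k = {c \<in> children k. feasible c}"
  using children_greater[of k] by (fastforce simp: available_def)

lemma placed_new: "k < n \<Longrightarrow> placed (Suc k) X k = {}"
  using children_greater[of k] by (fastforce simp: placed_def)

text \<open>If \<open>k\<close> was chosen below a chosen parent, its own local condition makes it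
  feasible, so it counted as available before. If it was the first choice, its local condition makes
  it startable.\<close>

lemma good_prev:
  assumes good: "good (Suc k) X" and k: "k < n" and n: "n \<notin> X"
  shows "good k X"
proof -
  have loc: "locally_good (Suc k) X v" if "v \<le> k" "v \<in> X" for v
    using good that by (auto simp: good_def)
  have loc': "locally_good k X v" if v: "v < k" "v \<in> X" for v
  proof -
    have "feasible k" if "k \<in> X" "par k = v"
      using loc[of k] that v k available_new[OF k, of X]
      by (auto simp: locally_good_def feasible_iff)
    then have "available (Suc k) X v \<subseteq> available k X v"
      by (auto simp: available_def children_def less_Suc_eq split: if_splits)
    then have "card (available (Suc k) X v) \<le> card (available k X v)"
      by (intro card_mono) auto
    moreover have "card (placed k X v) \<le> card (placed (Suc k) X v)"
      by (intro card_mono) (auto simp: placed_def)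
    ultimately show ?thesis
      using loc[of v] v by (auto simp: locally_good_def split: if_splits)
  qed
  have "card (tops k X) \<le> card (tops (Suc k) X)"
    by (intro card_mono) (auto simp: tops_def)
  moreover have "\<exists>r<n. k \<le> r \<and> startable r" if no: "\<forall>v<k. v \<notin> X"
  proof (cases "k \<in> X")
    case True
    have "par k \<notin> X"
      using par_cases[OF k] no n by auto
    then have "startable k"
      using loc[of k] True available_new[OF k, of X]
      by (simp add: locally_good_def startable_def)
    then show ?thesis using k by blast
  next
    case False
    then have "\<forall>v<Suc k. v \<notin> X"
      using no by (simp add: less_Suc_eq)
    then show ?thesis
      using good by (auto simp: good_def)
  qed
  ultimately show ?thesis
    using good loc' unfolding good_def by (meson le_trans)
qed

lemma good_step:
  assumes good: "good k X" and k: "k < n" and n: "n \<notin> X"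
  shows "good (Suc k) (X - {k}) \<or> good (Suc k) (insert k X)"
proof -
  have loc: "locally_good k X v" if "v < k" "v \<in> X" for v
    using good that by (auto simp: good_def)
  have par_k: "par k \<noteq> k" using par_ne[OF k] .
  have par_v: "par v \<noteq> k" if "v < k" for v
    using par_cases[of v] that k by auto
  have placed_del: "placed (Suc k) (X - {k}) v = placed k X v" for v
    by (auto simp: placed_def)
  have tops_del: "tops (Suc k) (X - {k}) = tops k X"
    using par_v by (auto simp: tops_def less_Suc_eq)
  have avail_del: "available (Suc k) (X - {k}) v = available k X v" if "par k \<noteq> v \<or> \<not> feasible k" for v
    using that by (auto simp: available_def children_def less_Suc_eq)
  have placed_ins: "placed (Suc k) (insert k X) v
      = (if par k = v then insert k (placed k X v) else placed k X v)" for v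
    using k by (auto simp: placed_def children_def less_Suc_eq)
  have avail_ins: "available (Suc k) (insert k X) v = available k X v" if "par k \<noteq> v \<or> feasible k" for v
    using that by (auto simp: available_def children_def less_Suc_eq)
  have new: "placed (Suc k) Y k = {}" "available (Suc k) Y k = {c \<in> children k. feasible c}" for Y
    using k by (simp_all add: placed_new available_new)
  show ?thesis
  proof (cases "par k \<in> X")
    case True
    define p where "p = par k"
    have p: "p < k" "p \<in> X"
      using True par_cases[OF k] n by (auto simp: p_def)
    have notin: "k \<notin> placed k X p" by (simp add: placed_def)
    show ?thesis
    \<comment> \<open>The sum counts the neighbours that \<open>p\<close> already has, its parent
      included.\<close>
    proof (cases "feasible k \<and> card (placed k X p) + (if par p \<in> X then 1 else 0) < half p")
      case True
      have "locally_good (Suc k) (insert k X) v" if v: "v < k" "v \<in> X" for v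
      proof (cases "v = p")
        case True
        then show ?thesis
          using \<open>feasible k \<and> _\<close> loc[of p] p notin par_v[of p]
          by (auto simp: locally_good_def placed_ins avail_ins p_def[symmetric] split: if_splits)
      next
        case False
        then show ?thesis
          using loc[of v] v par_v[of v]
          by (simp add: locally_good_def placed_ins avail_ins p_def[symmetric])
      qed
      moreover have "locally_good (Suc k) (insert k X) k"
        using True p k by (auto simp: locally_good_def new feasible_iff p_def[symmetric])
      moreover have "tops (Suc k) (insert k X) = tops k X"
        using p par_v by (auto simp: tops_def less_Suc_eq p_def)
      ultimately have "good (Suc k) (insert k X)"
        using good by (auto simp: good_def less_Suc_eq)
      then show ?thesis ..
    next
      case False
      have "locally_good (Suc k) (X - {k}) v" if v: "v < k" "v \<in> X" for v
      proof (cases "v = p \<and> feasible k")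
        case True
        \<comment> \<open>Here \<open>k\<close> is dropped although feasible, so the quota of
          \<open>p\<close> is full; the children placed so far meet it and remain available.\<close>
        have "placed k X p \<subseteq> available (Suc k) (X - {k}) p"
          by (auto simp: placed_def available_def)
        then have "card (placed k X p) \<le> card (available (Suc k) (X - {k}) p)"
          by (intro card_mono) auto
        then show ?thesis
          using True False loc[of p] p par_v[of p]
          by (auto simp: locally_good_def placed_del p_def[symmetric] split: if_splits)
      next
        case False
        then have "available (Suc k) (X - {k}) v = available k X v"
          by (intro avail_del) (auto simp: p_def)
        then show ?thesis
          using loc[of v] v par_v[of v] by (auto simp: locally_good_def placed_del)
      qed
      then have "good (Suc k) (X - {k})"
        using good p by (auto simp: good_def less_Suc_eq tops_del)
      then show ?thesis ..
    qed
  next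
    case no_par: False
    show ?thesis
    proof (cases "(\<exists>v<k. v \<in> X) \<or> (\<exists>r<n. Suc k \<le> r \<and> startable r)")
      case True
      have "locally_good (Suc k) (X - {k}) v" if v: "v < k" "v \<in> X" for v
      proof -
        have "available (Suc k) (X - {k}) v = available k X v"
          using v no_par by (intro avail_del) auto
        then show ?thesis
          using loc[of v] v par_v[of v] by (auto simp: locally_good_def placed_del)
      qed
      then have "good (Suc k) (X - {k})"
        using good True by (auto simp: good_def less_Suc_eq tops_del)
      then show ?thesis ..
    next
      case False
      \<comment> \<open>Nothing is chosen and no later position is startable, so the last conjunct
        of \<open>good k X\<close> leaves only \<open>k\<close> as a top.\<close>
      then have "startable k"
        using good by (auto simp: good_def) (metis Suc_leI le_neq_implies_less)
      then have "locally_good (Suc k) (insert k X) k"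
        using no_par par_k by (simp add: locally_good_def new startable_def)
      moreover have "tops (Suc k) (insert k X) \<subseteq> {k}"
        using False by (auto simp: tops_def less_Suc_eq)
      then have "card (tops (Suc k) (insert k X)) \<le> 1"
        by (metis card_mono finite.emptyI finite.insertI is_singletonI is_singleton_altdef)
      ultimately have "good (Suc k) (insert k X)"
        using False by (auto simp: good_def less_Suc_eq)
      then show ?thesis ..
    qed
  qed
qed

definition solutions :: "nat set set" where
  "solutions = {S. S \<subseteq> {..<n} \<and> good n S}"

lemma finite_solutions: "finite solutions"
  by (rule finite_subset[of _ "Pow {..<n}"]) (auto simp: solutions_def)

definition extensions :: "nat \<Rightarrow> nat set \<Rightarrow> nat set set" where
  "extensions k X = {S \<in> solutions. S \<inter> {..<k} = X \<inter> {..<k}}"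

text \<open>\<open>good_step\<close> carries a good prefix up to length \<open>n\<close>, and
  \<open>good_prev\<close> restricts a solution back down. One downward induction gives both
  directions; it starts at \<open>k = n\<close>, where at most \<open>X\<close> itself extends
  \<open>X\<close>.\<close>

lemma good_iff_extensions:
  assumes "k \<le> n" "X \<subseteq> {..<n}"
  shows "good k X \<longleftrightarrow> extensions k X \<noteq> {}"
  using assms
proof (induction k arbitrary: X rule: inc_induct)
  case base
  have "S = X" if "S \<in> extensions n X" for S
    using that base by (auto simp: extensions_def solutions_def)
  moreover have "X \<in> extensions n X" if "good n X"
    using that base by (auto simp: extensions_def solutions_def)
  ultimately show ?case
    by (metis (no_types, lifting) all_not_in_conv extensions_def mem_Collect_eq solutions_def)
next
  case (step k)
  have n: "n \<notin> X" using step.prems by auto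
  show ?case
  proof
    assume "good k X"
    then have "good (Suc k) (X - {k}) \<or> good (Suc k) (insert k X)"
      using step.hyps n by (intro good_step) auto
    then have "extensions (Suc k) (X - {k}) \<noteq> {} \<or> extensions (Suc k) (insert k X) \<noteq> {}"
      using step.IH[of "X - {k}"] step.IH[of "insert k X"] step.prems step.hyps by auto
    moreover have "extensions (Suc k) (X - {k}) \<subseteq> extensions k X"
        "extensions (Suc k) (insert k X) \<subseteq> extensions k X"
      by (auto simp: extensions_def lessThan_Suc)
    ultimately show "extensions k X \<noteq> {}" by blast
  next
    assume "extensions k X \<noteq> {}"
    then obtain S where S: "S \<in> solutions" "S \<inter> {..<k} = X \<inter> {..<k}"
      by (auto simp: extensions_def)
    then have "S \<subseteq> {..<n}" "n \<notin> S" by (auto simp: solutions_def)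
    moreover have "extensions (Suc k) S \<noteq> {}"
      using S by (auto simp: extensions_def)
    ultimately have "good (Suc k) S"
      using step.IH by blast
    then have "good k S"
      using good_prev step.hyps \<open>n \<notin> S\<close> by blast
    then show "good k X"
      using good_cong[OF S(2)] \<open>n \<notin> S\<close> n step.hyps by simp
  qed
qed

section \<open>Lexicographic order of the solutions, where omitting a position precedes choosing
  it\<close>

definition later :: "nat \<Rightarrow> nat set \<Rightarrow> nat set set" where
  "later k X = {S \<in> solutions. \<exists>j<k. j \<notin> X \<and> j \<in> S \<and> S \<inter> {..<j} = X \<inter> {..<j}}"

text \<open>The invariant of the enumeration: what remains to be output when the first
  \<open>k\<close> choices of \<open>X\<close> are about to be completed. The members of
  \<open>later\<close> follow all these completions in lexicographic order.\<close>

definition pending :: "nat \<Rightarrow> nat set \<Rightarrow> nat set set" where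
  "pending k X = extensions k X \<union> later k X"

lemma pending_0: "pending 0 X = solutions"
  by (auto simp: pending_def extensions_def later_def)

lemma later_0 [simp]: "later 0 X = {}"
  by (simp add: later_def)

lemma later_cong: "X \<inter> {..<k} = Y \<inter> {..<k} \<Longrightarrow> later k X = later k Y"
proof -
  have sub: "later k X \<subseteq> later k Y" if eq: "X \<inter> {..<k} = Y \<inter> {..<k}" for X Y
  proof
    fix S assume "S \<in> later k X"
    then obtain j where j: "S \<in> solutions" "j < k" "j \<notin> X" "j \<in> S" "S \<inter> {..<j} = X \<inter> {..<j}"
      by (auto simp: later_def)
    have "X \<inter> {..<j} = X \<inter> {..<k} \<inter> {..<j}" "Y \<inter> {..<j} = Y \<inter> {..<k} \<inter> {..<j}"
      using j(2) by auto
    then have "X \<inter> {..<j} = Y \<inter> {..<j}" "j \<notin> Y"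
      using eq j by (simp_all) blast
    then show "S \<in> later k Y" using j by (auto simp: later_def)
  qed
  assume "X \<inter> {..<k} = Y \<inter> {..<k}"
  then show ?thesis using sub[of X Y] sub[of Y X] by auto
qed

lemma later_Suc:
  "later (Suc k) X = (if k \<in> X then later k X else later k X \<union> extensions (Suc k) (insert k X))"
proof -
  have "k \<notin> X \<Longrightarrow> S \<in> extensions (Suc k) (insert k X) \<longleftrightarrow>
      S \<in> solutions \<and> k \<in> S \<and> S \<inter> {..<k} = X \<inter> {..<k}" for S
    unfolding extensions_def lessThan_Suc by (auto simp: set_eq_iff)
  then show ?thesis
    by (auto simp: later_def less_Suc_eq)
qed

lemma later_insert: "later k (insert k X) = later k X"
  by (rule later_cong) auto

text \<open>Backtracking: once position \<open>k\<close> is switched on, the solutions after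
  \<open>X\<close> that branch off at or before \<open>k\<close> are exactly the pending ones. Thus
  a single prefix represents a whole set of later solutions.\<close>

lemma later_Suc_notin: "k \<notin> X \<Longrightarrow> later (Suc k) X = pending (Suc k) (insert k X)"
  using later_Suc[of k X] later_Suc[of k "insert k X"] by (auto simp: pending_def later_insert)

lemma extensions_split:
  "extensions k X = extensions (Suc k) (X - {k}) \<union> extensions (Suc k) (insert k X)"
  unfolding extensions_def lessThan_Suc by (auto simp: set_eq_iff)

text \<open>Omitting \<open>k\<close> loses nothing: the branch that contains \<open>k\<close>
  merely moves from \<open>extensions\<close> to \<open>later\<close>.\<close>

lemma pending_del: "pending (Suc k) (X - {k}) = pending k X"
proof -
  have "later k (X - {k}) = later k X" by (rule later_cong) auto
  then show ?thesis
    using later_Suc[of k "X - {k}"] extensions_split[of k X] by (auto simp: pending_def)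
qed

text \<open>Switching \<open>k\<close> on skips the branch without \<open>k\<close>, which therefore
  has to be empty.\<close>

lemma pending_insert:
  "extensions (Suc k) (X - {k}) = {} \<Longrightarrow> pending (Suc k) (insert k X) = pending k X"
  using later_Suc[of k "insert k X"] extensions_split[of k X]
  by (auto simp: pending_def later_insert)

lemma pending_n: "X \<in> solutions \<Longrightarrow> pending n X = insert X (later n X)"
  by (auto simp: pending_def extensions_def solutions_def)

lemma notin_later: "X \<notin> later k X"
  by (auto simp: later_def)

section \<open>Solutions coincide with globally minimal defensive alliances\<close>

lemma edge_iff:
  assumes "v < n" "u < n"
  shows "{v, u} \<in> tree_edges \<longleftrightarrow> u \<in> children v \<or> u = par v"
proof -
  have "{v, u} \<in> tree_edges \<longleftrightarrow> (0 < u \<and> par u = v) \<or> (0 < v \<and> par v = u)"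
    using assms by (auto simp: tree_edges_def doubleton_eq_iff image_iff)
  then show ?thesis
    using assms par_root by (auto simp: children_def intro: gr0I)
qed

lemma deg_in_eq:
  assumes "v < n" "X \<subseteq> {..<n}"
  shows "deg_in tree_edges X v = card (children v \<inter> X) + of_bool (par v \<in> X)"
proof -
  have eq: "{u \<in> X. {v, u} \<in> tree_edges} = (children v \<inter> X) \<union> (if par v \<in> X then {par v} else {})"
    using assms edge_iff[of v] by (auto simp: subset_iff)
  have "par v \<notin> children v"
    using children_greater[OF assms(1), of "par v"] par_cases[OF assms(1)] by (auto simp: children_def)
  then show ?thesis
    unfolding deg_in_def eq by (simp add: card_insert_if)
qed

lemma half_eq: "v < n \<Longrightarrow> half v = deg_in tree_edges {..<n} v div 2"
proof -
  assume v: "v < n"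
  have "children v \<inter> {..<n} = children v" by (auto simp: children_def)
  moreover have "par v < n \<longleftrightarrow> v \<noteq> 0"
    using par_cases[OF v] v par_root by auto
  ultimately show ?thesis
    using deg_in_eq[OF v, of "{..<n}"] by (simp add: half_def)
qed

lemma deg_in_split:
  assumes "finite V" "A \<subseteq> V"
  shows "deg_in E V v = deg_in E A v + deg_in E (V - A) v"
proof -
  have "{u \<in> V. {v, u} \<in> E} = {u \<in> A. {v, u} \<in> E} \<union> {u \<in> V - A. {v, u} \<in> E}"
    using assms by auto
  then show ?thesis
    unfolding deg_in_def using assms
    by (simp add: card_Un_disjoint disjoint_iff finite_subset)
qed

text \<open>With \<open>a\<close> neighbours inside and \<open>b\<close> outside,
  \<open>b <= a + 1\<close> is equivalent to \<open>(a + b) div 2 <= a\<close>. This is the origin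
  of the threshold \<open>half\<close>.\<close>

lemma defensive_alliance_iff:
  assumes "A \<subseteq> {..<n}"
  shows "defensive_alliance {..<n} tree_edges A \<longleftrightarrow> (\<forall>v\<in>A. half v \<le> deg_in tree_edges A v)"
proof -
  have "deg_in tree_edges ({..<n} - A) v \<le> deg_in tree_edges A v + 1 \<longleftrightarrow> half v \<le> deg_in tree_edges A v"
    if "v \<in> A" for v
  proof -
    have arith: "b \<le> a + 1 \<longleftrightarrow> (a + b) div 2 \<le> a" for a b :: nat by presburger
    show ?thesis
      using that assms deg_in_split[OF _ assms, of tree_edges v] arith half_eq[of v] by auto
  qed
  then show ?thesis
    using assms by (simp add: defensive_alliance_def)
qed

lemma solutions_iff:
  "S \<in> solutions \<longleftrightarrow> S \<subseteq> {..<n} \<and> S \<noteq> {} \<and> card (tops n S) \<le> 1 \<and>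
     (\<forall>v\<in>S. deg_in tree_edges S v = half v)"
proof -
  have "locally_good n S v \<longleftrightarrow> deg_in tree_edges S v = half v" if "S \<subseteq> {..<n}" "v \<in> S" for v
  proof -
    have "placed n S v = children v \<inter> S" "available n S v = children v \<inter> S"
      by (auto simp: placed_def available_def children_def)
    then show ?thesis
      using that deg_in_eq[of v S] by (auto simp: locally_good_def)
  qed
  then show ?thesis
    unfolding solutions_def good_def by (auto simp: subset_iff)
qed

lemma tops_unique: "card (tops n S) \<le> 1 \<Longrightarrow> S \<subseteq> {..<n} \<Longrightarrow> a \<in> S \<Longrightarrow> par a \<notin> S \<Longrightarrow> b \<in> S \<Longrightarrow> par b \<notin> S
   \<Longrightarrow> a = b"
  using card_le_Suc0_iff_eq[of "tops n S"] by (auto simp: tops_def subset_iff)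

lemma least_in_tops:
  assumes "S \<subseteq> {..<n}" "v \<in> S" "\<And>u. u \<in> S \<Longrightarrow> v \<le> u"
  shows "par v \<notin> S"
  using assms(1,2) assms(3)[of "par v"] par_cases[of v] by auto

text \<open>Take the least member \<open>u\<close> of \<open>B\<close> and the least member
  \<open>w\<close> of \<open>A - B\<close>. Neither has its parent in its own part, and they cannot
  both be tops of \<open>A\<close>, so one of the two parent edges crosses.\<close>

lemma boundary_edge:
  assumes one: "card (tops n A) \<le> 1" and A: "A \<subseteq> {..<n}" and B: "B \<subset> A" "B \<noteq> {}"
  obtains u w where "u \<in> B" "w \<in> A - B" "{u, w} \<in> tree_edges"
proof -
  have edge: "{v, par v} \<in> tree_edges" "{par v, v} \<in> tree_edges" if "v \<in> A" "par v \<in> A" for v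
    using edge_iff[of v "par v"] that A by (auto simp: insert_commute)
  define u where "u = (LEAST u. u \<in> B)"
  define w where "w = (LEAST w. w \<in> A - B)"
  have u: "u \<in> B" "\<And>x. x \<in> B \<Longrightarrow> u \<le> x"
    using B LeastI_ex[of "\<lambda>u. u \<in> B"] unfolding u_def by (auto intro: Least_le)
  have w: "w \<in> A - B" "\<And>x. x \<in> A - B \<Longrightarrow> w \<le> x"
    using B LeastI_ex[of "\<lambda>w. w \<in> A - B"] unfolding w_def by (blast intro: Least_le)+
  have ub: "par u \<notin> B"
    using least_in_tops[OF _ u] A B by auto
  have wb: "par w \<notin> A - B"
    using least_in_tops[OF _ w] A by auto
  show ?thesis
  proof (cases "par u \<in> A")
    case True
    then show ?thesis using that[of u "par u"] u ub edge[of u] B by auto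
  next
    case False
    then have "par w \<in> A"
      using tops_unique[OF one A, of u w] u w B by auto
    then show ?thesis using that[of "par w" w] w wb edge[of w] by auto
  qed
qed

text \<open>No member has a neighbour to spare, so the end in \<open>B\<close> of a boundary edge
  falls below \<open>half\<close>.\<close>

lemma solutions_imp_minimal:
  assumes "A \<in> solutions"
  shows "globally_minimal_defensive_alliance {..<n} tree_edges A"
proof -
  have A: "A \<subseteq> {..<n}" "A \<noteq> {}" "card (tops n A) \<le> 1"
      and deg: "\<And>v. v \<in> A \<Longrightarrow> deg_in tree_edges A v = half v"
    using assms by (auto simp: solutions_iff)
  have fin: "finite A" using A(1) finite_subset by blast
  have "\<not> defensive_alliance {..<n} tree_edges B" if B: "B \<subset> A" "B \<noteq> {}" for B
  proof -
    obtain u w where uw: "u \<in> B" "w \<in> A - B" "{u, w} \<in> tree_edges"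
      using boundary_edge[OF A(3,1) B] .
    have "{x \<in> B. {u, x} \<in> tree_edges} \<subset> {x \<in> A. {u, x} \<in> tree_edges}"
      using uw B by auto
    then have "deg_in tree_edges B u < deg_in tree_edges A u"
      unfolding deg_in_def using fin by (intro psubset_card_mono) auto
    then show ?thesis
      using deg[of u] uw B A(1) defensive_alliance_iff[of B] by (auto simp: not_le)
  qed
  then show ?thesis
    using A deg defensive_alliance_iff[of A] by (auto simp: globally_minimal_defensive_alliance_def)
qed

text \<open>The part of \<open>A\<close> below \<open>w\<close>, reached by climbing parent edges
  inside \<open>A\<close> only. If \<open>A\<close> is connected, it is the lower component after
  cutting the edge above a member \<open>w\<close>.\<close>

definition descendants :: "nat set \<Rightarrow> nat \<Rightarrow> nat set" where
  "descendants A w = {u \<in> A. (u, w) \<in> {(c, par c) | c. c \<in> A \<and> par c \<in> A}\<^sup>*}"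

lemma descendants_refl: "w \<in> A \<Longrightarrow> w \<in> descendants A w"
  by (simp add: descendants_def)

text \<open>The edge above \<open>w\<close> is the only edge inside \<open>A\<close> that can leave
  the part below \<open>w\<close>; membership passes along all others in both directions.\<close>

lemma descendants_par:
  assumes "u \<in> A" "par u \<in> A" "u \<noteq> w"
  shows "par u \<in> descendants A w \<longleftrightarrow> u \<in> descendants A w"
proof
  assume "par u \<in> descendants A w"
  then show "u \<in> descendants A w"
    using assms by (auto simp: descendants_def intro: converse_rtrancl_into_rtrancl)
next
  assume "u \<in> descendants A w"
  then have "(u, w) \<in> {(c, par c) | c. c \<in> A \<and> par c \<in> A}\<^sup>*"
    by (simp add: descendants_def)
  then show "par u \<in> descendants A w"
    using assms by (cases rule: converse_rtranclE) (auto simp: descendants_def)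
qed

lemma descendants_le:
  assumes "A \<subseteq> {..<n}" "u \<in> descendants A w"
  shows "w \<le> u"
proof -
  have "(u, w) \<in> {(c, par c) | c. c \<in> A \<and> par c \<in> A}\<^sup>*"
    using assms by (simp add: descendants_def)
  then show ?thesis
  proof (induction rule: rtrancl_induct)
    case (step y z)
    then have "y < n" "par y < n" using assms(1) by auto
    then show ?case using par_cases[of y] step by auto
  qed simp
qed

lemma deg_in_closed:
  assumes "A \<subseteq> {..<n}" "B \<subseteq> A" "v \<in> B"
    and "par v \<in> A \<Longrightarrow> par v \<in> B" and "\<And>c. c \<in> A \<Longrightarrow> par c = v \<Longrightarrow> c \<in> B"
  shows "deg_in tree_edges B v = deg_in tree_edges A v"
proof -
  have "children v \<inter> B = children v \<inter> A" "par v \<in> B \<longleftrightarrow> par v \<in> A"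
    using assms by (auto simp: children_def)
  then show ?thesis
    using deg_in_eq[of v A] deg_in_eq[of v B] assms(1-3) by (auto simp: subset_iff)
qed

text \<open>Each violation yields a smaller alliance. Besides a second component, the only violation
  is a surplus member \<open>v\<close>: cutting an edge from \<open>v\<close> to a neighbour in
  \<open>A\<close> leaves a part in which \<open>v\<close> alone has lost a neighbour.\<close>

lemma minimal_imp_solutions:
  assumes "globally_minimal_defensive_alliance {..<n} tree_edges A"
  shows "A \<in> solutions"
proof -
  have A: "A \<subseteq> {..<n}" "A \<noteq> {}" and half: "\<And>v. v \<in> A \<Longrightarrow> half v \<le> deg_in tree_edges A v"
    using assms defensive_alliance_iff[of A]
    by (auto simp: globally_minimal_defensive_alliance_def defensive_alliance_def)
  have deficient: "\<exists>v\<in>B. deg_in tree_edges B v < half v" if "B \<subset> A" "B \<noteq> {}" for B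
  proof -
    have "\<not> defensive_alliance {..<n} tree_edges B"
      using assms that unfolding globally_minimal_defensive_alliance_def by blast
    moreover have "B \<subseteq> {..<n}" using that A(1) by blast
    ultimately show ?thesis
      using defensive_alliance_iff[of B] by (simp add: not_le)
  qed
  let ?D = "descendants A"
  have D: "?D w \<subseteq> A" for w by (auto simp: descendants_def)
  have D_deg: "deg_in tree_edges (?D w) v = deg_in tree_edges A v" if "v \<in> ?D w" "v \<noteq> w" for v w
  proof (rule deg_in_closed[OF A(1) D that(1)])
    show "par v \<in> ?D w" if "par v \<in> A"
      using descendants_par[OF _ that \<open>v \<noteq> w\<close>] \<open>v \<in> ?D w\<close> D[of w] by blast
    fix c assume c: "c \<in> A" "par c = v"
    have "c \<noteq> w"
      using c that descendants_le[OF A(1) that(1)] par_cases[of c] A(1) D by fastforce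
    have "par c \<in> ?D w" "par c \<in> A" using c(2) that(1) D[of w] by blast+
    then show "c \<in> ?D w"
      using descendants_par[OF c(1) _ \<open>c \<noteq> w\<close>] by blast
  qed
  have ch_D: "c \<in> ?D w" if "c \<in> A" "par c = w" "w \<in> A" for c w
  proof -
    have "c \<noteq> w" using par_ne[of c] that A(1) by auto
    then show ?thesis
      using descendants_par[OF that(1) _ \<open>c \<noteq> w\<close>] descendants_refl[OF that(3)] that by simp
  qed
  \<comment> \<open>The part below a top is closed under adjacency in \<open>A\<close>, so it is an
    alliance, and a second top lies outside it.\<close>
  have "a = b" if ab: "a \<in> A" "par a \<notin> A" "b \<in> A" "par b \<notin> A" for a b
  proof (rule ccontr)
    assume ne: "a \<noteq> b"
    have "b \<notin> ?D a"
    proof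
      assume "b \<in> ?D a"
      then have "(b, a) \<in> {(c, par c) | c. c \<in> A \<and> par c \<in> A}\<^sup>*"
        by (simp add: descendants_def)
      then show False
        using ab ne by (cases rule: converse_rtranclE) auto
    qed
    moreover have "deg_in tree_edges (?D a) v = deg_in tree_edges A v" if "v \<in> ?D a" for v
    proof (cases "v = a")
      case True
      show ?thesis
        unfolding True by (rule deg_in_closed[OF A(1) D]) (use ab ch_D[OF _ _ ab(1)] descendants_refl[OF ab(1)] in auto)
    qed (use D_deg[OF that] in auto)
    moreover have "?D a \<subset> A" "?D a \<noteq> {}"
      using calculation(1) ab D[of a] descendants_refl[of a A] by auto
    ultimately show False
      using deficient[of "?D a"] half D[of a] by fastforce
  qed
  then have tops: "card (tops n A) \<le> 1"
    using card_le_Suc0_iff_eq[of "tops n A"] by (auto simp: tops_def)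
  have "deg_in tree_edges A v = half v" if v: "v \<in> A" for v
  proof (rule ccontr)
    assume "deg_in tree_edges A v \<noteq> half v"
    then have more: "half v < deg_in tree_edges A v"
      using half[OF v] by simp
    have vn: "v < n" using v A(1) by auto
    show False
    proof (cases "par v \<in> A")
      \<comment> \<open>Cut above \<open>v\<close> and keep the lower part; \<open>v\<close> loses
        only its parent.\<close>
      case True
      have "par v \<notin> ?D v"
        using descendants_le[OF A(1), of "par v" v] par_cases[OF vn] True A(1) by auto
      moreover have "Suc (deg_in tree_edges (?D v) v) = deg_in tree_edges A v"
      proof -
        have "children v \<inter> ?D v = children v \<inter> A"
          using ch_D[OF _ _ v] D[of v] by (auto simp: children_def)
        then show ?thesis
          using deg_in_eq[OF vn A(1)] deg_in_eq[OF vn, of "?D v"] A(1) D[of v] True calculation by auto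
      qed
      moreover have "?D v \<subset> A" "?D v \<noteq> {}"
        using calculation(1) True v D[of v] descendants_refl[of v A] by auto
      ultimately show False
        using deficient[of "?D v"] D_deg[of _ v] half more D[of v] by (metis leD less_Suc_eq_le subsetD)
    next
      \<comment> \<open>There is no edge above \<open>v\<close> to cut, so the part below some child
        \<open>w\<close> is removed instead; \<open>v\<close> loses only \<open>w\<close>.\<close>
      case False
      then have "0 < card (children v \<inter> A)"
        using more deg_in_eq[OF vn A(1)] by simp
      then have "children v \<inter> A \<noteq> {}"
        unfolding card_gt_0_iff by blast
      then obtain w where w: "w \<in> A" "par w = v" "w < n"
        by (auto simp: children_def)
      let ?B = "A - ?D w"
      have vB: "v \<in> ?B"
        using v descendants_le[OF A(1), of v w] par_cases[of w] w vn by auto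
      have deg_B: "deg_in tree_edges ?B u = deg_in tree_edges A u" if "u \<in> ?B" "u \<noteq> v" for u
      proof (rule deg_in_closed[OF A(1) _ that(1)])
        show "par u \<in> ?B" if "par u \<in> A"
          using descendants_par[of u A w] that \<open>u \<in> ?B\<close> descendants_refl[of u A] by auto
        show "c \<in> ?B" if "c \<in> A" "par c = u" for c
          using descendants_par[of c A w] that \<open>u \<in> ?B\<close> \<open>u \<noteq> v\<close> w by auto
      qed auto
      have "Suc (deg_in tree_edges ?B v) = deg_in tree_edges A v"
      proof -
        have "c \<notin> ?D w" if "c \<in> A" "par c = v" "c \<noteq> w" for c
          using descendants_par[of c A w] that v vB by simp
        then have "children v \<inter> A = insert w (children v \<inter> ?B)"
          using w by (auto simp: children_def)
        moreover have "w \<notin> ?B" using descendants_refl w by auto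
        ultimately show ?thesis
          using deg_in_eq[OF vn A(1)] deg_in_eq[OF vn, of ?B] A(1) False by auto
      qed
      moreover have "?B \<subset> A" "?B \<noteq> {}"
        using vB w descendants_refl[of w A] by auto
      ultimately show False
        using deficient[of ?B] deg_B half more by (metis DiffD1 leD less_Suc_eq_le)
    qed
  qed
  then show ?thesis
    using A tops by (simp add: solutions_iff)
qed

lemma solutions_eq: "solutions = {A. globally_minimal_defensive_alliance {..<n} tree_edges A}"
  using minimal_imp_solutions solutions_imp_minimal by auto

section \<open>Number of solutions\<close>

definition last_child :: "nat \<Rightarrow> nat" where
  "last_child v = Max (children v)"

text \<open>The root is excluded as well: since \<open>par 0 = n\<close>, it is the last child of
  \<open>n\<close>. No information is lost, as the root can only be a member as the top.\<close>

definition deciding :: "nat set" where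
  "deciding = {v. v < n \<and> children v \<noteq> {} \<and> v \<noteq> last_child (par v)}"

lemma last_child: "children v \<noteq> {} \<Longrightarrow> last_child v \<in> children v"
  unfolding last_child_def by (intro Max_in) auto

text \<open>\<open>par\<close> inverts \<open>last_child\<close>, so the deciding vertices have
  equally many last children, and none of these is deciding.\<close>

lemma card_deciding: "2 * card deciding \<le> n"
proof -
  have par_last: "par (last_child v) = v" "last_child v < n" if "v \<in> deciding" for v
    using that last_child[of v] by (auto simp: deciding_def children_def)
  have "inj_on last_child deciding"
    by (rule inj_on_inverseI[of _ par]) (use par_last in auto)
  then have "card deciding = card (last_child ` deciding)"
    by (simp add: card_image)
  also have "\<dots> \<le> card ({..<n} - deciding)"
  proof (rule card_mono)
    show "last_child ` deciding \<subseteq> {..<n} - deciding"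
    proof safe
      fix v assume v: "v \<in> deciding"
      then show "last_child v < n" by (rule par_last)
      assume "last_child v \<in> deciding"
      then have "last_child v \<noteq> last_child (par (last_child v))" by (simp add: deciding_def)
      then show False using par_last(1)[OF v] by simp
    qed
  qed simp
  also have "\<dots> = n - card deciding"
    by (subst card_Diff_subset) (auto simp: deciding_def)
  finally show ?thesis by simp
qed

text \<open>Positions are settled in increasing order. A last child is forced, because the quota of
  its parent is fixed and its siblings precede it. A non-top vertex is never a member if it is a
  leaf or its parent is outside. The reverse inclusion follows by symmetry.\<close>

lemma solution_determined:
  assumes S: "S \<in> solutions" and T: "T \<in> solutions"
    and r: "r \<in> S" "par r \<notin> S" "r \<in> T" "par r \<notin> T" and eq: "S \<inter> deciding = T \<inter> deciding"
  shows "S \<subseteq> T"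
proof
  fix v assume "v \<in> S"
  have sub: "S \<subseteq> {..<n}" "T \<subseteq> {..<n}" using S T by (auto simp: solutions_iff)
  have deg: "deg_in tree_edges S v = half v" if "v \<in> S" for v
    using S that by (simp add: solutions_iff)
  have deg': "deg_in tree_edges T v = half v" if "v \<in> T" for v
    using T that by (simp add: solutions_iff)
  have nontop: "par v \<in> S" if "v \<in> S" "v \<noteq> r" for v
    using tops_unique[of S v r] S r that by (auto simp: solutions_iff)
  have nontop': "par v \<in> T" if "v \<in> T" "v \<noteq> r" for v
    using tops_unique[of T v r] T r that by (auto simp: solutions_iff)
  \<comment> \<open>A leaf has quota 0, but a non-top member has its parent as a neighbour.\<close>
  have leaf: "children v \<noteq> {}" if "v \<in> R" "v \<noteq> r" "R = S \<or> R = T" for R v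
  proof
    assume empty: "children v = {}"
    have "v < n" "R \<subseteq> {..<n}" using that sub by auto
    moreover have "deg_in tree_edges R v = half v" using deg deg' that by auto
    ultimately have "par v \<notin> R"
      using deg_in_eq[of v R] empty by (simp add: half_def split: if_splits)
    then show False using nontop nontop' that by auto
  qed
  have "v \<in> S \<longleftrightarrow> v \<in> T" if "v < n" for v
    using that
  proof (induction v rule: less_induct)
    case (less v)
    define p where "p = par v"
    show ?case
    proof (cases "v = r \<or> p \<notin> S \<or> children v = {}")
      case True
      moreover have "p \<in> S \<longleftrightarrow> p \<in> T"
        using less.IH[of p] par_cases[OF less.prems] less.prems sub by (auto simp: p_def)
      ultimately show ?thesis
        using r nontop nontop' leaf unfolding p_def by blast
    next
      case False
      then have p: "p < v" "p \<in> S" "p < n"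
        using par_cases[OF less.prems] sub by (auto simp: p_def)
      then have pT: "p \<in> T" using less.IH[of p] by auto
      show ?thesis
      proof (cases "v \<in> deciding")
        case True
        then show ?thesis using eq by auto
      next
        case notdec: False
        then have v: "v = last_child p"
          using False less.prems by (auto simp: deciding_def p_def)
        have vc: "v \<in> children p" using less.prems by (simp add: children_def p_def)
        have "c < v" if "c \<in> children p - {v}" for c
          using that Max_ge[of "children p" c] unfolding v last_child_def
          by (metis DiffE finite_children le_neq_implies_less singletonI)
        then have "c \<in> S \<longleftrightarrow> c \<in> T" if "c \<in> children p - {v}" for c
          using less.IH[of c] that less.prems by fastforce
        then have rest: "(children p - {v}) \<inter> S = (children p - {v}) \<inter> T"
          by auto
        have split: "card (children p \<inter> R) = card ((children p - {v}) \<inter> R) + of_bool (v \<in> R)" for R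
        proof (cases "v \<in> R")
          case True
          then have "children p \<inter> R = insert v ((children p - {v}) \<inter> R)" using vc by auto
          then show ?thesis using True by simp
        next
          case False
          then have "children p \<inter> R = (children p - {v}) \<inter> R" by auto
          then show ?thesis using False by simp
        qed
        have "par p \<in> S \<longleftrightarrow> par p \<in> T"
          using less.IH[of "par p"] par_cases[OF p(3)] p sub by auto
        \<comment> \<open>Both degrees of \<open>p\<close> equal \<open>half p\<close> and the
          parent of \<open>p\<close> contributes equally, so the numbers of chosen children agree;
          only \<open>v\<close> is left to account for.\<close>
        then have "card (children p \<inter> S) = card (children p \<inter> T)"
          using deg[OF p(2)] deg'[OF pT] deg_in_eq[OF p(3) sub(1)] deg_in_eq[OF p(3) sub(2)] by simp
        then have "of_bool (v \<in> S) = (of_bool (v \<in> T) :: nat)"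
          using split[of S] split[of T] unfolding rest by linarith
        then show ?thesis by (cases "v \<in> S"; cases "v \<in> T") simp_all
      qed
    qed
  qed
  then show "v \<in> T" using \<open>v \<in> S\<close> sub by auto
qed

text \<open>Since parents precede children, the least member of a solution is its top. The factor
  \<open>n\<close> counts the possible tops.\<close>

lemma card_solutions: "card solutions \<le> n * 2 ^ (n div 2)"
proof -
  define f where "f S = (LEAST v. v \<in> S, S \<inter> deciding)" for S :: "nat set"
  have top: "(LEAST v. v \<in> S) \<in> S \<and> par (LEAST v. v \<in> S) \<notin> S" if "S \<in> solutions" for S
  proof -
    have "S \<noteq> {}" "S \<subseteq> {..<n}" using that by (auto simp: solutions_iff)
    then have "(LEAST v. v \<in> S) \<in> S"
      using LeastI_ex[of "\<lambda>v. v \<in> S"] by blast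
    then show ?thesis
      using least_in_tops[of S "LEAST v. v \<in> S"] \<open>S \<subseteq> {..<n}\<close> by (auto intro: Least_le)
  qed
  have "inj_on f solutions"
  proof (rule inj_onI)
    fix S T assume ST: "S \<in> solutions" "T \<in> solutions" and "f S = f T"
    then have "(LEAST v. v \<in> S) = (LEAST v. v \<in> T)" "S \<inter> deciding = T \<inter> deciding"
      by (simp_all add: f_def)
    moreover define r where "r = (LEAST v. v \<in> S)"
    ultimately have r: "r \<in> S" "par r \<notin> S" "r \<in> T" "par r \<notin> T"
        and eq: "S \<inter> deciding = T \<inter> deciding"
      using top[OF ST(1)] top[OF ST(2)] by simp_all
    show "S = T"
      using solution_determined[OF ST r eq] solution_determined[OF ST(2,1) r(3,4,1,2) eq[symmetric]]
      by (rule subset_antisym)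
  qed
  moreover have "f S \<in> {..<n} \<times> Pow deciding" if "S \<in> solutions" for S
    using top[OF that] that by (auto simp: f_def solutions_def)
  then have "f ` solutions \<subseteq> {..<n} \<times> Pow deciding" by blast
  moreover have fin: "finite deciding" by (simp add: deciding_def)
  ultimately have "card solutions \<le> card ({..<n} \<times> Pow deciding)"
    by (intro card_inj_on_le[of f]) auto
  also have "\<dots> = n * 2 ^ card deciding"
    using fin by (simp add: card_Pow card_cartesian_product)
  also have "\<dots> \<le> n * 2 ^ (n div 2)"
    using card_deciding by (intro mult_left_mono power_increasing) auto
  finally show ?thesis .
qed

end

section \<open>Programs without output\<close>

lemma update_same [simp]:
  "update m a i j x a k l = (if k = i \<and> l = j then x else m a k l)"
  by (simp add: update_def)

lemma update_other [simp]: "b \<noteq> a \<Longrightarrow> update m a i j x b = m b"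
  by (simp add: update_def)

text \<open>Adding the two branches instead of taking their maximum keeps the bound a polynomial in
  \<open>N\<close>.\<close>

primrec cost :: "nat \<Rightarrow> com \<Rightarrow> nat" where
  "cost N Skip = 1"
| "cost N (Assign a i j e) = 1"
| "cost N (Write e) = 1"
| "cost N Emit = 1"
| "cost N (Seq c d) = cost N c + cost N d"
| "cost N (IfElse b c d) = 1 + cost N c + cost N d"
| "cost N (While b c) = 1 + N * (1 + cost N c)"

lemma cost_poly: "\<exists>p :: nat poly. \<forall>N. cost N c = poly p N"
proof (induction c)
  case (Seq c d)
  then obtain p q :: "nat poly" where "\<forall>N. cost N c = poly p N" "\<forall>N. cost N d = poly q N" by blast
  then show ?case by (intro exI[of _ "p + q"]) simp
next
  case (IfElse b c d)
  then obtain p q :: "nat poly" where "\<forall>N. cost N c = poly p N" "\<forall>N. cost N d = poly q N" by blast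
  then show ?case by (intro exI[of _ "1 + p + q"]) simp
next
  case (While b c)
  then obtain p :: "nat poly" where "\<forall>N. cost N c = poly p N" by blast
  then show ?case by (intro exI[of _ "1 + [:0, 1:] * (1 + p)"]) simp
qed (auto intro: exI[of _ 1])

text \<open>
  Weakest precondition for programs without output, under the additional demand that every
  execution of every loop makes at most \<open>N\<close> iterations; \<open>cost N\<close> then bounds the running time.
\<close>

primrec wp :: "nat \<Rightarrow> com \<Rightarrow> (memory \<Rightarrow> bool) \<Rightarrow> memory \<Rightarrow> bool" where
  "wp N Skip Q m = Q m"
| "wp N (Assign a i j e) Q m = Q (update m a (aval i m) (aval j m) (aval e m))"
| "wp N (Write e) Q m = False"
| "wp N Emit Q m = False"
| "wp N (Seq c d) Q m = wp N c (wp N d Q) m"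
| "wp N (IfElse b c d) Q m = (if bval b m then wp N c Q m else wp N d Q m)"
| "wp N (While b c) Q m =
     ((\<lambda>R m. if bval b m then wp N c R m else Q m) ^^ N) (\<lambda>m. \<not> bval b m \<and> Q m) m"

lemma wp_mono:
  assumes "wp N c Q m" "\<And>m. Q m \<Longrightarrow> R m"
  shows "wp N c R m"
  using assms
proof (induction c arbitrary: Q R m)
  case (Seq c d)
  have "wp N d R m'" if "wp N d Q m'" for m'
    using Seq.IH(2)[of Q m' R] that Seq.prems(2) by simp
  then show ?case
    using Seq.prems(1) Seq.IH(1)[of "wp N d Q" m "wp N d R"] by simp
next
  case (While b c)
  \<comment> \<open>\<open>W T k\<close> is the precondition with at most \<open>k\<close>
    iterations left. At \<open>k = 0\<close> the guard must already be false, so a loop that exceeds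
    its budget is rejected.\<close>
  define W where "W T k = ((\<lambda>S m. if bval b m then wp N c S m else T m) ^^ k) (\<lambda>m. \<not> bval b m \<and> T m)"
    for T k
  have W_Suc: "W T (Suc k) m = (if bval b m then wp N c (W T k) m else T m)" for T k m
    by (simp add: W_def)
  have "W R k m" if "W Q k m" for k m
    using that
  proof (induction k arbitrary: m)
    case 0
    then show ?case using While.prems(2) by (simp add: W_def)
  next
    case (Suc k)
    then show ?case
      using While.prems(2) While.IH[of "W Q k" m "W R k"] by (simp add: W_Suc split: if_splits)
  qed
  then show ?case using While.prems(1) by (simp add: W_def)
qed (auto split: if_splits)

lemma wp_sound:
  assumes "wp N c Q m"
  shows "\<exists>tr m'. exec c m tr m' \<and> set tr \<subseteq> {Tick} \<and> length tr \<le> cost N c \<and> Q m'"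
  using assms
proof (induction c arbitrary: Q m)
  case Skip
  then show ?case by (intro exI[of _ "[Tick]"] exI[of _ m]) (auto intro: exec.intros)
next
  case (Assign a i j e)
  then show ?case by (auto intro!: exI[of _ "[Tick]"] exI exec.intros)
next
  case (Seq c d)
  from Seq.IH(1)[of "wp N d Q" m] Seq.prems obtain tr m' where
    1: "exec c m tr m'" "set tr \<subseteq> {Tick}" "length tr \<le> cost N c" "wp N d Q m'" by auto
  from Seq.IH(2)[OF 1(4)] obtain tr' m'' where
    2: "exec d m' tr' m''" "set tr' \<subseteq> {Tick}" "length tr' \<le> cost N d" "Q m''" by auto
  show ?case
    using 1 2 by (intro exI[of _ "tr @ tr'"] exI[of _ m'']) (auto intro: exec.intros)
next
  case (IfElse b c d)
  show ?case
  proof (cases "bval b m")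
    case True
    with IfElse.IH(1)[of Q m] IfElse.prems obtain tr m' where
      "exec c m tr m'" "set tr \<subseteq> {Tick}" "length tr \<le> cost N c" "Q m'" by auto
    then show ?thesis
      using True by (intro exI[of _ "Tick # tr"] exI[of _ m']) (auto intro: exec.IfTrue)
  next
    case False
    with IfElse.IH(2)[of Q m] IfElse.prems obtain tr m' where
      "exec d m tr m'" "set tr \<subseteq> {Tick}" "length tr \<le> cost N d" "Q m'" by auto
    then show ?thesis
      using False by (intro exI[of _ "Tick # tr"] exI[of _ m']) (auto intro: exec.IfFalse)
  qed
next
  case (While b c)
  have "\<exists>tr m'. exec (While b c) m tr m' \<and> set tr \<subseteq> {Tick} \<and>
      length tr \<le> 1 + k * (1 + cost N c) \<and> Q m'"
    if "((\<lambda>S m. if bval b m then wp N c S m else Q m) ^^ k) (\<lambda>m. \<not> bval b m \<and> Q m) m" for k m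
    using that
  proof (induction k arbitrary: m)
    case 0
    then show ?case
      by (intro exI[of _ "[Tick]"] exI[of _ m]) (auto intro: exec.WhileFalse)
  next
    case (Suc k)
    show ?case
    proof (cases "bval b m")
      case True
      then have "wp N c (((\<lambda>S m. if bval b m then wp N c S m else Q m) ^^ k)
          (\<lambda>m. \<not> bval b m \<and> Q m)) m"
        using Suc.prems by simp
      from While.IH[OF this] Suc.IH obtain tr m' tr' m'' where
        "exec c m tr m'" "set tr \<subseteq> {Tick}" "length tr \<le> cost N c"
        "exec (While b c) m' tr' m''" "set tr' \<subseteq> {Tick}" "length tr' \<le> 1 + k * (1 + cost N c)"
        "Q m''" by blast
      then show ?thesis
        using True by (intro exI[of _ "Tick # tr @ tr'"] exI[of _ m'']) (auto intro: exec.WhileTrue)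
    next
      case False
      then show ?thesis
        using Suc.prems
        by (intro exI[of _ "[Tick]"] exI[of _ m]) (auto intro: exec.WhileFalse)
    qed
  qed
  then show ?case using While.prems by simp
qed auto

abbreviation scalar :: "nat \<Rightarrow> aexp" where
  "scalar a \<equiv> Entry a (Const 0) (Const 0)"

abbreviation entry :: "nat \<Rightarrow> aexp \<Rightarrow> aexp" where
  "entry a i \<equiv> Entry a i (Const 0)"

abbreviation set_scalar :: "nat \<Rightarrow> aexp \<Rightarrow> com" where
  "set_scalar a e \<equiv> Assign a (Const 0) (Const 0) e"

abbreviation set_entry :: "nat \<Rightarrow> aexp \<Rightarrow> aexp \<Rightarrow> com" where
  "set_entry a i e \<equiv> Assign a i (Const 0) e"

notation Seq (infixr ";;" 60)

definition For :: "nat \<Rightarrow> com \<Rightarrow> com" where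
  "For i c = set_scalar i (Const 0) ;;
     While (Less (scalar i) (scalar 0)) (c ;; set_scalar i (Inc (scalar i)))"

text \<open>The invariant is evaluated after the counter has been advanced, so it may speak about
  the whole memory. As the body preserves bound and counter, there are \<open>n\<close> iterations,
  and one budget \<open>N\<close> serves all nested loops.\<close>

lemma wp_For:
  assumes i: "i \<noteq> 0" and n: "m 0 0 0 = n" and N: "n \<le> N"
    and init: "I 0 (update m i 0 0 0)"
    and step: "\<And>j m. j < n \<Longrightarrow> I j m \<Longrightarrow> m 0 0 0 = n \<Longrightarrow> m i 0 0 = j \<Longrightarrow>
      wp N c (\<lambda>m'. m' 0 0 0 = n \<and> m' i 0 0 = j \<and> I (Suc j) (update m' i 0 0 (Suc j))) m"
    and final: "\<And>m. I n m \<Longrightarrow> m 0 0 0 = n \<Longrightarrow> m i 0 0 = n \<Longrightarrow> Q m"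
  shows "wp N (For i c) Q m"
proof -
  let ?b = "Less (scalar i) (scalar 0)"
  let ?c = "c ;; set_scalar i (Inc (scalar i))"
  define W where "W k = ((\<lambda>S m. if bval ?b m then wp N ?c S m else Q m) ^^ k) (\<lambda>m. \<not> bval ?b m \<and> Q m)" for k
  have W_Suc: "W (Suc k) m = (if bval ?b m then wp N ?c (W k) m else Q m)" for k m
    by (simp add: W_def)
  have loop: "W k m" if "I j m" "m 0 0 0 = n" "m i 0 0 = j" "j \<le> n" "n \<le> j + k" for j k m
    using that
  proof (induction k arbitrary: j m)
    case 0
    then show ?case using final by (auto simp: W_def)
  next
    case (Suc k)
    show ?case
    proof (cases "j < n")
      case True
      have "wp N c (wp N (set_scalar i (Inc (scalar i))) (W k)) m"
      proof (rule wp_mono[OF step[OF True Suc.prems(1-3)]])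
        fix m' assume "m' 0 0 0 = n \<and> m' i 0 0 = j \<and> I (Suc j) (update m' i 0 0 (Suc j))"
        then show "wp N (set_scalar i (Inc (scalar i))) (W k) m'"
          using Suc.IH[of "Suc j" "update m' i 0 0 (Suc j)"] Suc.prems True i by simp
      qed
      then show ?thesis using True Suc.prems(2,3) by (simp add: W_Suc)
    next
      case False
      then show ?thesis using Suc.prems final by (auto simp: W_Suc)
    qed
  qed
  show ?thesis
    using loop[OF init, of N] n i N by (simp add: For_def W_def)
qed

section \<open>Testing and completing a prefix\<close>

text \<open>
  Vertices are represented by their positions. Arrays: \<open>2\<close> vertex at a position, \<open>3\<close> parent
  (\<open>n\<close> for the root), \<open>4\<close> visited vertices, \<open>5\<close> prescribed number of neighbours \<open>half\<close>,
  \<open>6\<close> \<open>feasible\<close>, \<open>7\<close> \<open>startable\<close>, \<open>8\<close> current set. Scalars: \<open>9\<close> length of the prefix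
  tested by \<open>check\<close>, with answer in \<open>26\<close>; \<open>10\<close> length plus one of the prefix to be completed
  next, or \<open>0\<close> if there are no further solutions. All other arrays are auxiliary scalars.
\<close>

definition same_except :: "nat set \<Rightarrow> memory \<Rightarrow> memory \<Rightarrow> bool" where
  "same_except A m m' \<longleftrightarrow> (\<forall>a. a \<notin> A \<longrightarrow> m' a = m a)"

lemma same_except_refl [simp]: "same_except A m m"
  by (simp add: same_except_def)

lemma same_except_update [simp]:
  "same_except A m m' \<Longrightarrow> a \<in> A \<Longrightarrow> same_except A m (update m' a i j x)"
  unfolding same_except_def by (metis update_other)

lemma same_exceptD: "same_except A m m' \<Longrightarrow> a \<notin> A \<Longrightarrow> m' a = m a"
  by (simp add: same_except_def)

lemma same_except_trans:
  "same_except A m m' \<Longrightarrow> same_except B m' m'' \<Longrightarrow> A \<subseteq> C \<Longrightarrow> B \<subseteq> C \<Longrightarrow> same_except C m m''"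
  unfolding same_except_def by (metis subsetD)

lemma card_less_Suc:
  "card {c. c < Suc j \<and> P c} = card {c. c < j \<and> P c} + (if P j then 1 else 0)"
proof -
  have "{c. c < Suc j \<and> P c} = (if P j then insert j {c. c < j \<and> P c} else {c. c < j \<and> P c})"
    by (auto simp: less_Suc_eq)
  then show ?thesis by simp
qed

text \<open>The vertex under test is in scalar \<open>20\<close>; scalars \<open>22\<close> and
  \<open>23\<close> collect the sizes of \<open>placed\<close> and \<open>available\<close>.\<close>

definition count_children :: com where
  "count_children = For 21
     (IfElse (Equal (entry 3 (scalar 21)) (scalar 20))
       (IfElse (Less (scalar 21) (scalar 9))
         (IfElse (Equal (entry 8 (scalar 21)) (Const 1))
           (set_scalar 22 (Inc (scalar 22)) ;; set_scalar 23 (Inc (scalar 23)))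
           Skip)
         (IfElse (Equal (entry 6 (scalar 21)) (Const 1))
           (set_scalar 23 (Inc (scalar 23)))
           Skip))
       Skip)"

text \<open>Scalar \<open>24\<close> counts tops, \<open>25\<close> records the non-emptiness clause
  of \<open>good\<close>, and \<open>26\<close> is cleared when a local condition fails.\<close>

definition judge_vertex :: com where
  "judge_vertex =
     IfElse (Less (scalar 20) (scalar 9))
       (IfElse (Equal (entry 8 (scalar 20)) (Const 1))
         (set_scalar 25 (Const 1) ;;
          IfElse (Equal (entry 8 (entry 3 (scalar 20))) (Const 1))
            (IfElse (Conj (Less (scalar 22) (entry 5 (scalar 20)))
                (Neg (Less (Inc (scalar 23)) (entry 5 (scalar 20)))))
              Skip (set_scalar 26 (Const 0)))
            (set_scalar 24 (Inc (scalar 24)) ;;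
             IfElse (Conj (Neg (Less (entry 5 (scalar 20)) (scalar 22)))
                (Neg (Less (scalar 23) (entry 5 (scalar 20)))))
              Skip (set_scalar 26 (Const 0))))
         Skip)
       (IfElse (Equal (entry 7 (scalar 20)) (Const 1)) (set_scalar 25 (Const 1)) Skip)"

definition check_vertex :: com where
  "check_vertex =
     set_scalar 22 (Const 0) ;; set_scalar 23 (Const 0) ;; count_children ;; judge_vertex"

definition check :: com where
  "check =
     set_scalar 24 (Const 0) ;; set_scalar 25 (Const 0) ;; set_scalar 26 (Const 1) ;;
     For 20 check_vertex ;;
     IfElse (Conj (Less (scalar 24) (Const 2)) (Less (Const 0) (scalar 25)))
       Skip (set_scalar 26 (Const 0))"

text \<open>This builds the lexicographically first completion. A position whose omission fails is
  switched on without a second test, which \<open>good_step\<close> justifies.\<close>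

definition complete_prefix :: com where
  "complete_prefix = For 11
     (IfElse (Less (Inc (scalar 11)) (scalar 10)) Skip
       (set_entry 8 (scalar 11) (Const 0) ;; set_scalar 9 (Inc (scalar 11)) ;; check ;;
        IfElse (Equal (scalar 26) (Const 1)) Skip (set_entry 8 (scalar 11) (Const 1))))"

text \<open>The lexicographic successor branches off at the last position that can be switched on.
  An upward scan that overwrites scalar \<open>10\<close> finds it: for position \<open>j\<close>
  the value is \<open>j + 2\<close>, encoding prefix length \<open>j + 1\<close>, and two decrements
  recover \<open>j\<close>. Entries after \<open>j\<close> may be stale, since the next completion
  overwrites them.\<close>

definition advance :: com where
  "advance =
     set_scalar 10 (Const 0) ;;
     For 11
      (IfElse (Equal (entry 8 (scalar 11)) (Const 1)) Skip
        (set_entry 8 (scalar 11) (Const 1) ;; set_scalar 9 (Inc (scalar 11)) ;; check ;;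
         IfElse (Equal (scalar 26) (Const 1)) (set_scalar 10 (Inc (Inc (scalar 11)))) Skip ;;
         set_entry 8 (scalar 11) (Const 0))) ;;
     IfElse (Less (Const 0) (scalar 10)) (set_entry 8 (Dec (Dec (scalar 10))) (Const 1)) Skip"

section \<open>Correctness of testing, completing and advancing\<close>

context rooted_tree
begin

text \<open>Entry \<open>n\<close> of array \<open>8\<close> must not read as a member, because the
  membership of the root's parent is looked up there.\<close>

definition tables :: "memory \<Rightarrow> bool" where
  "tables m \<longleftrightarrow> m 0 0 0 = n \<and> m 8 n 0 \<noteq> 1 \<and>
     (\<forall>v<n. m 3 v 0 = par v \<and> m 5 v 0 = half v \<and>
       (m 6 v 0 = 1 \<longleftrightarrow> feasible v) \<and> (m 7 v 0 = 1 \<longleftrightarrow> startable v))"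

definition chosen :: "memory \<Rightarrow> nat set" where
  "chosen m = {v. v < n \<and> m 8 v 0 = 1}"

lemma chosen_subset: "chosen m \<subseteq> {..<n}"
  by (auto simp: chosen_def)

lemma notin_chosen [simp]: "n \<notin> chosen m"
  by (simp add: chosen_def)

lemma in_chosen: "v < n \<Longrightarrow> v \<in> chosen m \<longleftrightarrow> m 8 v 0 = 1"
  by (simp add: chosen_def)

lemma par_in_chosen:
  assumes "tables m" "v < n"
  shows "par v \<in> chosen m \<longleftrightarrow> m 8 (par v) 0 = 1"
  using par_cases[OF assms(2)] assms by (auto simp: chosen_def tables_def)

lemma chosen_update [simp]:
  "b \<noteq> 8 \<Longrightarrow> chosen (update m b i j x) = chosen m"
  "chosen (update m 8 v 0 0) = chosen m - {v}"
  "v < n \<Longrightarrow> chosen (update m 8 v 0 (Suc 0)) = insert v (chosen m)"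
  by (auto simp: chosen_def)

lemma tables_cong:
  assumes "same_except A m m'" "A \<inter> {0, 3, 5, 6, 7, 8} = {}"
  shows "tables m' = tables m" "chosen m' = chosen m"
proof -
  have "m' a = m a" if "a \<in> {0, 3, 5, 6, 7, 8}" for a
    using assms that by (auto simp: same_except_def)
  then have "m' 0 = m 0" "m' 3 = m 3" "m' 5 = m 5" "m' 6 = m 6" "m' 7 = m 7" "m' 8 = m 8"
    by simp_all
  then show "tables m' = tables m" "chosen m' = chosen m"
    by (simp_all add: tables_def chosen_def)
qed

lemma tables_update:
  "tables m \<Longrightarrow> b = 8 \<and> i \<noteq> n \<or> b \<notin> {0, 3, 5, 6, 7, 8} \<Longrightarrow> tables (update m b i j x)"
  by (auto simp: tables_def)

lemma wp_count_children:
  assumes m: "tables m" "m 20 0 0 = v" "m 9 0 0 = k" "m 22 0 0 = 0" "m 23 0 0 = 0"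
  shows "wp n count_children (\<lambda>m'. same_except {21, 22, 23} m m' \<and>
    m' 22 0 0 = card (placed k (chosen m) v) \<and>
    m' 23 0 0 = card (available k (chosen m) v)) m"
  unfolding count_children_def
proof (rule wp_For[where I = "\<lambda>j m'. same_except {21, 22, 23} m m' \<and>
    m' 22 0 0 = card {c. c < j \<and> par c = v \<and> c < k \<and> c \<in> chosen m} \<and>
    m' 23 0 0 = card {c. c < j \<and> par c = v \<and> (if c < k then c \<in> chosen m else feasible c)}"])
  show "m 0 0 0 = n" using m by (simp add: tables_def)
next
  fix j m'
  assume j: "j < n" "m' 0 0 0 = n" "m' 21 0 0 = j"
    and I: "same_except {21, 22, 23} m m' \<and>
    m' 22 0 0 = card {c. c < j \<and> par c = v \<and> c < k \<and> c \<in> chosen m} \<and>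
    m' 23 0 0 = card {c. c < j \<and> par c = v \<and> (if c < k then c \<in> chosen m else feasible c)}"
  have same: "same_except {21, 22, 23} m m'" using I by simp
  note eqs = same_exceptD[OF same]
  have t: "m 3 j 0 = par j" "m 6 j 0 = 1 \<longleftrightarrow> feasible j"
    using m(1) j(1) by (simp_all add: tables_def)
  show "wp n (IfElse (Equal (entry 3 (scalar 21)) (scalar 20))
       (IfElse (Less (scalar 21) (scalar 9))
         (IfElse (Equal (entry 8 (scalar 21)) (Const 1))
           (set_scalar 22 (Inc (scalar 22)) ;; set_scalar 23 (Inc (scalar 23)))
           Skip)
         (IfElse (Equal (entry 6 (scalar 21)) (Const 1))
           (set_scalar 23 (Inc (scalar 23)))
           Skip))
       Skip)
     (\<lambda>m'. m' 0 0 0 = n \<and> m' 21 0 0 = j \<and>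
        same_except {21, 22, 23} m (update m' 21 0 0 (Suc j)) \<and>
        update m' 21 0 0 (Suc j) 22 0 0 = card {c. c < Suc j \<and> par c = v \<and> c < k \<and> c \<in> chosen m} \<and>
        update m' 21 0 0 (Suc j) 23 0 0
          = card {c. c < Suc j \<and> par c = v \<and> (if c < k then c \<in> chosen m else feasible c)}) m'"
    using I j same t m(2,3) in_chosen[OF j(1), of m] unfolding card_less_Suc
    by (simp add: eqs)
next
  fix m'
  assume I: "same_except {21, 22, 23} m m' \<and>
    m' 22 0 0 = card {c. c < n \<and> par c = v \<and> c < k \<and> c \<in> chosen m} \<and>
    m' 23 0 0 = card {c. c < n \<and> par c = v \<and> (if c < k then c \<in> chosen m else feasible c)}"
  have "placed k (chosen m) v = {c. c < n \<and> par c = v \<and> c < k \<and> c \<in> chosen m}"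
    "available k (chosen m) v = {c. c < n \<and> par c = v \<and> (if c < k then c \<in> chosen m else feasible c)}"
    by (auto simp: placed_def available_def children_def)
  then show "same_except {21, 22, 23} m m' \<and>
    m' 22 0 0 = card (placed k (chosen m) v) \<and> m' 23 0 0 = card (available k (chosen m) v)"
    using I by simp
qed (use m in auto)

lemma wp_check:
  assumes m: "tables m" "m 9 0 0 = k" and k: "k \<le> n"
  shows "wp n check (\<lambda>m'. same_except {20, 21, 22, 23, 24, 25, 26} m m' \<and>
    (m' 26 0 0 = 1 \<longleftrightarrow> good k (chosen m))) m"
proof -
  let ?A = "{20, 21, 22, 23, 24, 25, 26} :: nat set"
  let ?X = "chosen m"
  \<comment> \<open>Each scalar tracks one conjunct of \<open>good\<close>, restricted to the
    vertices that the loop has visited.\<close>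
  define I where "I v m' \<longleftrightarrow> same_except ?A m m' \<and>
      m' 24 0 0 = card {u. u < v \<and> u < k \<and> u \<in> ?X \<and> par u \<notin> ?X} \<and>
      (0 < m' 25 0 0 \<longleftrightarrow> (\<exists>u<v. if u < k then u \<in> ?X else startable u)) \<and>
      (m' 26 0 0 = 1 \<longleftrightarrow> (\<forall>u<v. u < k \<longrightarrow> u \<in> ?X \<longrightarrow> locally_good k ?X u))" for v m'
  have step: "wp n check_vertex (\<lambda>m'. m' 0 0 0 = n \<and> m' 20 0 0 = v \<and>
      I (Suc v) (update m' 20 0 0 (Suc v))) m'"
    if v: "v < n" "I v m'" "m' 0 0 0 = n" "m' 20 0 0 = v" for v m'
  proof -
    have same: "same_except ?A m m'" using v by (simp add: I_def)
    let ?m = "update (update m' 22 0 0 0) 23 0 0 0"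
    have same': "same_except ?A m ?m" using same by simp
    have count: "wp n count_children (\<lambda>m''. same_except {21, 22, 23} ?m m'' \<and>
      m'' 22 0 0 = card (placed k (chosen ?m) v) \<and>
      m'' 23 0 0 = card (available k (chosen ?m) v)) ?m"
    proof (rule wp_count_children)
      show "tables ?m" using tables_cong(1)[OF same'] m(1) by simp
      show "?m 9 0 0 = k" using same_exceptD[OF same', of 9] m(2) by simp
    qed (use v in simp_all)
    have X: "chosen ?m = ?X" using tables_cong(2)[OF same'] by simp
    have t: "m 3 v 0 = par v" "m 5 v 0 = half v" "m 7 v 0 = 1 \<longleftrightarrow> startable v"
      using m(1) v(1) by (simp_all add: tables_def)
    have "wp n count_children (wp n judge_vertex (\<lambda>m'. m' 0 0 0 = n \<and> m' 20 0 0 = v \<and>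
      I (Suc v) (update m' 20 0 0 (Suc v)))) ?m"
    proof (rule wp_mono[OF count])
      fix m''
      assume post: "same_except {21, 22, 23} ?m m'' \<and>
        m'' 22 0 0 = card (placed k (chosen ?m) v) \<and>
        m'' 23 0 0 = card (available k (chosen ?m) v)"
      have same2: "same_except ?A m m''"
        using same_except_trans[OF same', of "{21, 22, 23}" m'' ?A] post by simp
      have vals: "m'' 0 0 0 = n" "m'' 20 0 0 = v" "m'' 9 0 0 = k" "m'' 3 v 0 = par v"
          "m'' 5 v 0 = half v" "m'' 7 v 0 = 1 \<longleftrightarrow> startable v" "m'' 8 v 0 = 1 \<longleftrightarrow> v \<in> ?X"
          "m'' 8 (par v) 0 = 1 \<longleftrightarrow> par v \<in> ?X"
        using same_exceptD[OF same2] same_exceptD[of "{21, 22, 23}" ?m m'' 20] post v m t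
          in_chosen[OF v(1), of m] par_in_chosen[OF m(1) v(1)] by (simp_all add: tables_def)
      have flags: "m'' 24 = m' 24" "m'' 25 = m' 25" "m'' 26 = m' 26"
        using same_exceptD[of "{21, 22, 23}" ?m m''] post by simp_all
      have counts: "m'' 22 0 0 = card (placed k ?X v)" "m'' 23 0 0 = card (available k ?X v)"
        using post X by simp_all
      show "wp n judge_vertex (\<lambda>m'. m' 0 0 0 = n \<and> m' 20 0 0 = v \<and>
          I (Suc v) (update m' 20 0 0 (Suc v))) m''"
      proof -
        let ?a = "card (placed k ?X v)" and ?b = "card (available k ?X v)"
        have lg: "locally_good k ?X v \<longleftrightarrow> (if par v \<in> ?X then ?a < half v \<and> \<not> ?b + 1 < half v
            else \<not> half v < ?a \<and> \<not> ?b < half v)"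
          by (auto simp: locally_good_def not_less)
        consider "\<not> v < k" | "v < k" "v \<notin> ?X" | "v < k" "v \<in> ?X" "par v \<in> ?X"
          | "v < k" "v \<in> ?X" "par v \<notin> ?X" by blast
        then show ?thesis
          using v(2) same2 unfolding judge_vertex_def I_def card_less_Suc All_less_Suc Ex_less_Suc
          by cases (simp_all add: vals flags counts lg del: One_nat_def)
      qed
    qed
    then show ?thesis by (simp add: check_vertex_def)
  qed
  let ?m0 = "update (update (update m 24 0 0 0) 25 0 0 0) 26 0 0 1"
  have "wp n (For 20 check_vertex) (wp n (IfElse (Conj (Less (scalar 24) (Const 2)) (Less (Const 0) (scalar 25)))
       Skip (set_scalar 26 (Const 0))) (\<lambda>m'. same_except ?A m m' \<and> (m' 26 0 0 = 1 \<longleftrightarrow> good k ?X))) ?m0"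
  proof (rule wp_For[where I = I])
    show "?m0 0 0 0 = n" using m by (simp add: tables_def)
    show "I 0 (update ?m0 20 0 0 0)" by (simp add: I_def)
  next
    fix m'
    assume I: "I n m'"
    have tops: "tops k ?X = {u. u < n \<and> u < k \<and> u \<in> ?X \<and> par u \<notin> ?X}"
      using k by (auto simp: tops_def)
    have ex: "(\<exists>u<n. if u < k then u \<in> ?X else startable u) \<longleftrightarrow>
        (\<exists>v<k. v \<in> ?X) \<or> (\<exists>r<n. k \<le> r \<and> startable r)"
    proof
      assume "\<exists>u<n. if u < k then u \<in> ?X else startable u"
      then obtain u where u: "u < n" "if u < k then u \<in> ?X else startable u" by blast
      then show "(\<exists>v<k. v \<in> ?X) \<or> (\<exists>r<n. k \<le> r \<and> startable r)"
        by (cases "u < k") (auto simp: not_less)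
    next
      assume "(\<exists>v<k. v \<in> ?X) \<or> (\<exists>r<n. k \<le> r \<and> startable r)"
      then show "\<exists>u<n. if u < k then u \<in> ?X else startable u"
      proof (elim disjE exE conjE)
        fix v assume "v < k" "v \<in> ?X"
        then show ?thesis using k by (intro exI[of _ v]) simp
      next
        fix r assume "r < n" "k \<le> r" "startable r"
        then show ?thesis by (intro exI[of _ r]) simp
      qed
    qed
    have all: "(\<forall>u<n. u < k \<longrightarrow> u \<in> ?X \<longrightarrow> locally_good k ?X u) \<longleftrightarrow>
        (\<forall>u<k. u \<in> ?X \<longrightarrow> locally_good k ?X u)"
      using k by auto
    have same: "same_except ?A m m'" and flags: "m' 24 0 0 < 2 \<longleftrightarrow> card (tops k ?X) \<le> 1"
        "0 < m' 25 0 0 \<longleftrightarrow> (\<exists>v<k. v \<in> ?X) \<or> (\<exists>r<n. k \<le> r \<and> startable r)"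
        "m' 26 0 0 = 1 \<longleftrightarrow> (\<forall>u<k. u \<in> ?X \<longrightarrow> locally_good k ?X u)"
      using I unfolding I_def tops ex all by auto
    have "good k ?X \<longleftrightarrow> m' 26 0 0 = 1 \<and> m' 24 0 0 < 2 \<and> 0 < m' 25 0 0"
      unfolding good_def flags by blast
    then show "wp n (IfElse (Conj (Less (scalar 24) (Const 2)) (Less (Const 0) (scalar 25)))
       Skip (set_scalar 26 (Const 0))) (\<lambda>m'. same_except ?A m m' \<and> (m' 26 0 0 = 1 \<longleftrightarrow> good k ?X)) m'"
      using same by simp
  qed (use step in auto)
  then show ?thesis by (simp add: check_def)
qed

lemma extensions_empty:
  assumes "j < n" "X \<subseteq> {..<n}" "\<not> good (Suc j) X"
  shows "extensions (Suc j) X = {}"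
  using good_iff_extensions[of "Suc j" X] assms by auto

text \<open>Every decision preserves the pending solutions: an omission by
  \<open>pending_del\<close>, a forced choice by \<open>pending_insert\<close>. The prefix stays
  good up to length \<open>n\<close>, where it is a solution.\<close>

lemma wp_complete_prefix:
  assumes m: "tables m" "m 10 0 0 = Suc k" "k \<le> n" "good k (chosen m)"
  shows "wp n complete_prefix (\<lambda>m'. same_except {8, 9, 11, 20, 21, 22, 23, 24, 25, 26} m m' \<and> tables m' \<and>
    chosen m' \<in> solutions \<and> pending n (chosen m') = pending k (chosen m)) m"
proof -
  let ?A = "{8, 9, 11, 20, 21, 22, 23, 24, 25, 26} :: nat set"
  \<comment> \<open>The rounds below \<open>k\<close> change nothing, hence
    \<open>max j k\<close>.\<close>
  define I where "I j m' \<longleftrightarrow> same_except ?A m m' \<and> tables m' \<and>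
      good (max j k) (chosen m') \<and> pending (max j k) (chosen m') = pending k (chosen m)" for j m'
  show ?thesis
    unfolding complete_prefix_def
  proof (rule wp_For[where I = I])
    show "m 0 0 0 = n" using m by (simp add: tables_def)
    show "I 0 (update m 11 0 0 0)"
      using m by (simp add: I_def tables_update)
  next
    fix m' assume I: "I n m'"
    have "max n k = n" using m by simp
    then show "same_except ?A m m' \<and> tables m' \<and> chosen m' \<in> solutions \<and>
        pending n (chosen m') = pending k (chosen m)"
      using I chosen_subset[of m'] by (simp add: I_def solutions_def)
  next
    fix j m' assume j: "j < n" "I j m'" "m' 0 0 0 = n" "m' 11 0 0 = j"
    let ?body = "set_entry 8 (scalar 11) (Const 0) ;; set_scalar 9 (Inc (scalar 11)) ;; check ;;
        IfElse (Equal (scalar 26) (Const 1)) Skip (set_entry 8 (scalar 11) (Const 1))"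
    let ?Q = "\<lambda>m'. m' 0 0 0 = n \<and> m' 11 0 0 = j \<and> I (Suc j) (update m' 11 0 0 (Suc j))"
    have same: "same_except ?A m m'" and tab: "tables m'"
        and good: "good (max j k) (chosen m')" and pend: "pending (max j k) (chosen m') = pending k (chosen m)"
      using j by (simp_all add: I_def)
    have k': "m' 10 0 0 = Suc k" using same_exceptD[OF same, of 10] m by simp
    show "wp n (IfElse (Less (Inc (scalar 11)) (scalar 10)) Skip ?body) ?Q m'"
    proof (cases "j < k")
      case True
      then have "max (Suc j) k = max j k" by simp
      then show ?thesis
        using True j k' by (simp add: I_def tables_update)
    next
      case False
      let ?m = "update (update m' 8 j 0 0) 9 0 0 (Suc j)"
      have same': "same_except ?A m ?m" using same by simp
      have tab': "tables ?m" using tab j by (simp add: tables_update)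
      have X: "chosen ?m = chosen m' - {j}" by simp
      have "max j k = j" "max (Suc j) k = Suc j" using False by auto
      note mx = this
      have good_j: "good j (chosen m')" using good mx by simp
      have "wp n check (wp n (IfElse (Equal (scalar 26) (Const 1)) Skip (set_entry 8 (scalar 11) (Const 1))) ?Q) ?m"
      proof (rule wp_mono[OF wp_check[where k = "Suc j"]])
        fix m''
        assume post: "same_except {20, 21, 22, 23, 24, 25, 26} ?m m'' \<and>
          (m'' 26 0 0 = 1 \<longleftrightarrow> good (Suc j) (chosen ?m))"
        note frame = conjunct1[OF post]
        have same'': "same_except ?A m m''"
          using same_except_trans[OF same' frame, of ?A] by simp
        have tab'': "tables m''" and X'': "chosen m'' = chosen m' - {j}"
          using tables_cong[OF frame] tab' X by simp_all
        have vals: "m'' 0 0 0 = n" "m'' 11 0 0 = j"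
          using same_exceptD[OF frame] j by simp_all
        show "wp n (IfElse (Equal (scalar 26) (Const 1)) Skip (set_entry 8 (scalar 11) (Const 1))) ?Q m''"
        proof (cases "good (Suc j) (chosen m' - {j})")
          case True
          then show ?thesis
            using post X vals same'' tab'' X'' pend mx
            by (simp add: I_def tables_update pending_del)
        next
          case False
          then have "good (Suc j) (insert j (chosen m'))"
            using good_step[OF good_j j(1)] by simp
          moreover have "extensions (Suc j) (chosen m' - {j}) = {}"
            using False chosen_subset[of m'] j(1) by (intro extensions_empty) auto
          ultimately show ?thesis
            using False post X vals same'' tab'' X'' pend mx j(1)
            by (simp add: I_def tables_update pending_insert)
        qed
      qed (use tab' j in auto)
      then show ?thesis
        using False j k' by simp
    qed
  qed (use m in auto)
qed

text \<open>If switching a position on succeeds, \<open>later_Suc_notin\<close> identifies the new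
  pending set with all later solutions so far; if it fails, its branch is empty and
  \<open>later_Suc\<close> adds nothing.\<close>

lemma wp_advance:
  assumes m: "tables m"
  shows "wp n advance (\<lambda>m'. same_except {8, 9, 10, 11, 20, 21, 22, 23, 24, 25, 26} m m' \<and> tables m' \<and>
    (m' 10 0 0 = 0 \<and> later n (chosen m) = {} \<or>
     (\<exists>k\<le>n. m' 10 0 0 = Suc k \<and> good k (chosen m') \<and> pending k (chosen m') = later n (chosen m)))) m"
proof -
  let ?A = "{8, 9, 10, 11, 20, 21, 22, 23, 24, 25, 26} :: nat set"
  let ?X = "chosen m"
  \<comment> \<open>\<open>i\<close> is the last successful position so far. Each trial is undone,
    so memory holds \<open>?X\<close> and the switched set appears only as
    \<open>insert i ?X\<close>.\<close>
  define I where "I j m' \<longleftrightarrow> same_except ?A m m' \<and> tables m' \<and> chosen m' = ?X \<and>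
      (m' 10 0 0 = 0 \<and> later j ?X = {} \<or>
       (\<exists>i<n. m' 10 0 0 = Suc (Suc i) \<and> good (Suc i) (insert i ?X) \<and>
          pending (Suc i) (insert i ?X) = later j ?X))" for j m'
  let ?final = "IfElse (Less (Const 0) (scalar 10)) (set_entry 8 (Dec (Dec (scalar 10))) (Const 1)) Skip"
  let ?post = "\<lambda>m'. same_except ?A m m' \<and> tables m' \<and> (m' 10 0 0 = 0 \<and> later n ?X = {} \<or>
     (\<exists>k\<le>n. m' 10 0 0 = Suc k \<and> good k (chosen m') \<and> pending k (chosen m') = later n ?X))"
  let ?body = "set_entry 8 (scalar 11) (Const 1) ;; set_scalar 9 (Inc (scalar 11)) ;; check ;;
         IfElse (Equal (scalar 26) (Const 1)) (set_scalar 10 (Inc (Inc (scalar 11)))) Skip ;;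
         set_entry 8 (scalar 11) (Const 0)"
  have "wp n (For 11 (IfElse (Equal (entry 8 (scalar 11)) (Const 1)) Skip ?body)) (wp n ?final ?post)
     (update m 10 0 0 0)"
  proof (rule wp_For[where I = I])
    show "update m 10 0 0 0 0 0 0 = n" using m by (simp add: tables_def)
    show "I 0 (update (update m 10 0 0 0) 11 0 0 0)"
      using m by (simp add: I_def tables_update)
  next
    fix m' assume I: "I n m'"
    then consider "m' 10 0 0 = 0" "later n ?X = {}" | i where "i < n" "m' 10 0 0 = Suc (Suc i)"
        "good (Suc i) (insert i ?X)" "pending (Suc i) (insert i ?X) = later n ?X"
      by (auto simp: I_def)
    then show "wp n ?final ?post m'"
      using I by cases (auto simp: I_def tables_update)
  next
    fix j m' assume j: "j < n" "I j m'" "m' 0 0 0 = n" "m' 11 0 0 = j"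
    let ?Q = "\<lambda>m'. m' 0 0 0 = n \<and> m' 11 0 0 = j \<and> I (Suc j) (update m' 11 0 0 (Suc j))"
    have same: "same_except ?A m m'" and tab: "tables m'" and X': "chosen m' = ?X"
      using j by (simp_all add: I_def)
    have mem: "m' 8 j 0 = 1 \<longleftrightarrow> j \<in> ?X"
      using in_chosen[OF j(1), of m'] X' by simp
    show "wp n (IfElse (Equal (entry 8 (scalar 11)) (Const 1)) Skip ?body) ?Q m'"
    proof (cases "j \<in> ?X")
      case True
      then have "later (Suc j) ?X = later j ?X" by (simp add: later_Suc)
      then show ?thesis
        using True j mem by (simp add: I_def tables_update)
    next
      case False
      let ?m = "update (update m' 8 j 0 1) 9 0 0 (Suc j)"
      have same': "same_except ?A m ?m" using same by simp
      have tab': "tables ?m" using tab j by (simp add: tables_update)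
      have X: "chosen ?m = insert j ?X" using j(1) X' by simp
      have "wp n check (wp n (IfElse (Equal (scalar 26) (Const 1)) (set_scalar 10 (Inc (Inc (scalar 11)))) Skip ;;
         set_entry 8 (scalar 11) (Const 0)) ?Q) ?m"
      proof (rule wp_mono[OF wp_check[where k = "Suc j"]])
        fix m''
        assume post: "same_except {20, 21, 22, 23, 24, 25, 26} ?m m'' \<and>
          (m'' 26 0 0 = 1 \<longleftrightarrow> good (Suc j) (chosen ?m))"
        note frame = conjunct1[OF post]
        have same'': "same_except ?A m m''"
          using same_except_trans[OF same' frame, of ?A] by simp
        have tab'': "tables m''" and X'': "chosen m'' = insert j ?X"
          using tables_cong[OF frame] tab' X by simp_all
        have vals: "m'' 0 0 0 = n" "m'' 11 0 0 = j" "m'' 10 0 0 = m' 10 0 0"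
          using same_exceptD[OF frame] j by simp_all
        have del: "insert j ?X - {j} = ?X" using False by simp
        show "wp n (IfElse (Equal (scalar 26) (Const 1)) (set_scalar 10 (Inc (Inc (scalar 11)))) Skip ;;
            set_entry 8 (scalar 11) (Const 0)) ?Q m''"
        proof (cases "good (Suc j) (insert j ?X)")
          case True
          then show ?thesis
            using post X vals same'' tab'' X'' del j(1) later_Suc_notin[OF False]
            by (simp add: I_def tables_update)
        next
          case no: False
          have "extensions (Suc j) (insert j ?X) = {}"
            using no chosen_subset[of m] j(1) by (intro extensions_empty) auto
          then have "later (Suc j) ?X = later j ?X"
            using False by (simp add: later_Suc)
          then show ?thesis
            using no post X vals same'' tab'' X'' del j(1,2)
            by (simp add: I_def tables_update)
        qed
      qed (use tab' j in auto)
      then show ?thesis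
        using False j mem by simp
    qed
  qed (use m in auto)
  then show ?thesis by (simp add: advance_def)
qed

end

section \<open>The enumeration loop\<close>

lemma blocks_append:
  "Emitted \<notin> set p \<Longrightarrow> blocks (p @ tr) = (p @ hd (blocks tr)) # tl (blocks tr)"
proof (induction p)
  case Nil
  then show ?case using blocks_nonempty[of tr] by simp
next
  case (Cons ev p)
  then show ?case by (cases ev) auto
qed

lemma blocks_append_Emitted:
  "Emitted \<notin> set p \<Longrightarrow> blocks (p @ Emitted # tr) = (p @ [Emitted]) # blocks tr"
  by (simp add: blocks_append)

lemma outputs_append_Emitted:
  "Emitted \<notin> set p \<Longrightarrow> outputs (p @ Emitted # tr) = {x. Written x \<in> set p} # outputs tr"
  by (simp add: outputs_def blocks_append_Emitted blocks_nonempty)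

lemma delays_append_Emitted:
  "Emitted \<notin> set p \<Longrightarrow> delays (p @ Emitted # tr) = Suc (length p) # delays tr"
  by (simp add: delays_def blocks_append_Emitted)

lemma outputs_append_quiet:
  assumes "set q \<subseteq> {Tick}"
  shows "outputs (q @ tr) = outputs tr"
proof -
  have "Emitted \<notin> set q" "\<And>x. Written x \<notin> set q" using assms by auto
  then show ?thesis
    using blocks_nonempty[of tr] by (cases "blocks tr") (simp_all add: outputs_def blocks_append)
qed

lemma delays_append_quiet:
  assumes "set q \<subseteq> {Tick}"
  shows "delays (q @ tr) = (length q + hd (delays tr)) # tl (delays tr)"
proof -
  have "Emitted \<notin> set q" using assms by auto
  then show ?thesis
    using blocks_nonempty[of tr] by (cases "blocks tr") (simp_all add: delays_def blocks_append)
qed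

lemma length_delays: "length (delays tr) = Suc (length (outputs tr))"
  using blocks_nonempty[of tr] by (simp add: delays_def outputs_def)

text \<open>The blocks make up the whole run, and there is one more of them than outputs. This turns
  a delay bound and a count of solutions into a bound on total time.\<close>

lemma length_le_delays:
  assumes "\<forall>d\<in>set (delays tr). d \<le> D"
  shows "length tr \<le> Suc (length (outputs tr)) * D"
proof -
  have sum_le: "sum_list ds \<le> length ds * D" if "\<forall>d\<in>set ds. d \<le> D" for ds :: "nat list"
    using that by (induction ds) auto
  have "length tr = sum_list (delays tr)"
    using concat_blocks[of tr] by (metis delays_def length_concat)
  also have "\<dots> \<le> length (delays tr) * D"
    using sum_le assms by blast
  finally show ?thesis by (simp add: length_delays)
qed

definition write_chosen :: com where
  "write_chosen = For 12
     (IfElse (Equal (entry 8 (scalar 12)) (Const 1)) (Write (entry 2 (scalar 12))) Skip)"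

text \<open>\<open>wp\<close> rejects output commands, so this loop is executed explicitly. A round
  takes four steps: guard, test, \<open>Write\<close> or \<open>Skip\<close>, and increment.\<close>

lemma exec_write_chosen:
  assumes n: "m 0 0 0 = n"
  shows "\<exists>tr m'. exec write_chosen m tr m' \<and> Emitted \<notin> set tr \<and>
    {x. Written x \<in> set tr} = (\<lambda>v. m 2 v 0) ` {v. v < n \<and> m 8 v 0 = 1} \<and>
    length tr \<le> cost n write_chosen \<and> same_except {12} m m'"
proof -
  let ?c = "IfElse (Equal (entry 8 (scalar 12)) (Const 1)) (Write (entry 2 (scalar 12))) Skip"
  let ?W = "While (Less (scalar 12) (scalar 0)) (?c ;; set_scalar 12 (Inc (scalar 12)))"
  have loop: "\<exists>tr m''. exec ?W m' tr m'' \<and> Emitted \<notin> set tr \<and>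
      {x. Written x \<in> set tr} = (\<lambda>v. m 2 v 0) ` {v. j \<le> v \<and> v < n \<and> m 8 v 0 = 1} \<and>
      length tr \<le> 1 + k * 4 \<and> same_except {12} m m''"
    if "same_except {12} m m'" "m' 12 0 0 = j" "n = j + k" for j k m'
    using that
  proof (induction k arbitrary: j m')
    case 0
    have "\<not> bval (Less (scalar 12) (scalar 0)) m'"
      using 0 n same_exceptD[OF 0(1), of 0] by simp
    then have "exec ?W m' [Tick] m'" by (rule exec.WhileFalse)
    then show ?case using 0 by (intro exI[of _ "[Tick]"] exI[of _ m']) auto
  next
    case (Suc k)
    have vals: "m' 0 0 0 = n" "m' 8 j 0 = m 8 j 0" "m' 2 j 0 = m 2 j 0"
      using n same_exceptD[OF Suc.prems(1)] by simp_all
    let ?m = "update m' 12 0 0 (Suc j)"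
    define ev where "ev = (if m 8 j 0 = 1 then Written (m 2 j 0) else Tick)"
    have "exec ?c m' [Tick, ev] m'"
    proof (cases "m 8 j 0 = 1")
      case True
      then have "exec ?c m' (Tick # [Written (aval (entry 2 (scalar 12)) m')]) m'"
        using vals Suc.prems(2) by (intro exec.IfTrue exec.Write) simp
      then show ?thesis using True vals Suc.prems(2) by (simp add: ev_def)
    next
      case False
      then have "exec ?c m' (Tick # [Tick]) m'"
        using vals Suc.prems(2) by (intro exec.IfFalse exec.Skip) simp
      then show ?thesis using False by (simp add: ev_def)
    qed
    moreover have "exec (set_scalar 12 (Inc (scalar 12))) m' [Tick] ?m"
      using exec.Assign[of 12 "Const 0" "Const 0" "Inc (scalar 12)" m'] Suc.prems(2) by simp
    ultimately have body: "exec (?c ;; set_scalar 12 (Inc (scalar 12))) m' ([Tick, ev] @ [Tick]) ?m"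
      by (rule exec.Seq)
    obtain tr m'' where IH: "exec ?W ?m tr m''" "Emitted \<notin> set tr"
        "{x. Written x \<in> set tr} = (\<lambda>v. m 2 v 0) ` {v. Suc j \<le> v \<and> v < n \<and> m 8 v 0 = 1}"
        "length tr \<le> 1 + k * 4" "same_except {12} m m''"
      using Suc.IH[of ?m "Suc j"] Suc.prems by auto
    have "bval (Less (scalar 12) (scalar 0)) m'"
      using vals Suc.prems by simp
    from exec.WhileTrue[OF this body IH(1)]
    have "exec ?W m' (Tick # ([Tick, ev] @ [Tick]) @ tr) m''" .
    moreover have "{x. Written x \<in> set (Tick # ([Tick, ev] @ [Tick]) @ tr)}
        = {x. Written x = ev} \<union> {x. Written x \<in> set tr}"
      by auto
    moreover have "\<dots> = (\<lambda>v. m 2 v 0) ` {v. j \<le> v \<and> v < n \<and> m 8 v 0 = 1}"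
    proof -
      have "{v. j \<le> v \<and> v < n \<and> m 8 v 0 = 1}
          = (if m 8 j 0 = 1 then {j} else {}) \<union> {v. Suc j \<le> v \<and> v < n \<and> m 8 v 0 = 1}"
        using Suc.prems(3) by (auto simp: le_less Suc_le_eq)
      moreover have "{x. Written x = ev} = (\<lambda>v. m 2 v 0) ` (if m 8 j 0 = 1 then {j} else {})"
        by (auto simp: ev_def)
      ultimately show ?thesis
        unfolding IH(3) by (simp only: image_Un)
    qed
    moreover have "Emitted \<notin> set (Tick # ([Tick, ev] @ [Tick]) @ tr)"
      using IH(2) by (auto simp: ev_def)
    ultimately show ?case
      using IH(4,5) by (intro exI[of _ "Tick # ([Tick, ev] @ [Tick]) @ tr"] exI[of _ m'']) simp
  qed
  obtain tr m' where tr: "exec ?W (update m 12 0 0 0) tr m'" "Emitted \<notin> set tr"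
      "{x. Written x \<in> set tr} = (\<lambda>v. m 2 v 0) ` {v. v < n \<and> m 8 v 0 = 1}"
      "length tr \<le> 1 + n * 4" "same_except {12} m m'"
    using loop[of "update m 12 0 0 0" 0 n] by auto
  have "exec (set_scalar 12 (Const 0)) m [Tick] (update m 12 0 0 0)"
    using exec.Assign[of 12 "Const 0" "Const 0" "Const 0" m] by simp
  from exec.Seq[OF this tr(1)] have "exec write_chosen m ([Tick] @ tr) m'"
    by (simp add: write_chosen_def For_def)
  then show ?thesis
    using tr by (intro exI[of _ "[Tick] @ tr"] exI[of _ m']) (simp add: write_chosen_def For_def)
qed

definition enumerate_loop :: com where
  "enumerate_loop =
     While (Less (Const 0) (scalar 10)) (complete_prefix ;; write_chosen ;; Emit ;; advance)"

text \<open>The summand 2 pays for the loop guard and \<open>Emit\<close>.\<close>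

definition round_cost :: "nat \<Rightarrow> nat" where
  "round_cost N = 2 + cost N complete_prefix + cost N write_chosen + cost N advance"

context rooted_tree
begin

text \<open>A delay spans the \<open>advance\<close> of one round and the beginning of the next,
  hence twice \<open>round_cost\<close>. The separate bound on the first block is what allows the
  two to be joined. Injectivity of \<open>lab\<close> keeps the outputs distinct after
  renaming.\<close>

lemma exec_enumerate_loop:
  assumes m: "tables m" "\<And>v. v < n \<Longrightarrow> m 2 v 0 = lab v" and inj: "inj_on lab {..<n}"
    and R: "m 10 0 0 = 0 \<and> R = {} \<or>
      (\<exists>k\<le>n. m 10 0 0 = Suc k \<and> good k (chosen m) \<and> pending k (chosen m) = R)"
  shows "\<exists>tr m'. exec enumerate_loop m tr m' \<and> distinct (outputs tr) \<and>
    set (outputs tr) = (`) lab ` R \<and> hd (delays tr) \<le> round_cost n \<and>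
    (\<forall>d\<in>set (delays tr). d \<le> 2 * round_cost n)"
proof -
  have sub: "R \<subseteq> solutions" using R by (auto simp: pending_def extensions_def later_def)
  then have "finite R" using finite_solutions finite_subset by blast
  then show ?thesis
    using m R sub
  proof (induction "card R" arbitrary: R m rule: less_induct)
    case less
    show ?case
    proof (cases "m 10 0 0 = 0")
      case True
      then have "exec enumerate_loop m [Tick] m"
        unfolding enumerate_loop_def by (intro exec.WhileFalse) simp
      moreover have "R = {}" using True less.prems by auto
      ultimately show ?thesis
        by (intro exI[of _ "[Tick]"] exI[of _ m])
          (simp add: outputs_def delays_def round_cost_def)
    next
      case False
      then obtain k where k: "k \<le> n" "m 10 0 0 = Suc k" "good k (chosen m)" "pending k (chosen m) = R"
        using less.prems by auto
      obtain trc m1 where c: "exec complete_prefix m trc m1" "set trc \<subseteq> {Tick}" "length trc \<le> cost n complete_prefix"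
          "same_except {8, 9, 11, 20, 21, 22, 23, 24, 25, 26} m m1" "tables m1"
          "chosen m1 \<in> solutions" "pending n (chosen m1) = R"
        using wp_sound[OF wp_complete_prefix[OF less.prems(2) k(2,1,3)]] k(4) by auto
      have lab1: "m1 2 v 0 = lab v" if "v < n" for v
        using same_exceptD[OF c(4), of 2] less.prems(3)[OF that] by simp
      obtain trw m2 where w: "exec write_chosen m1 trw m2" "Emitted \<notin> set trw"
          "{x. Written x \<in> set trw} = (\<lambda>v. m1 2 v 0) ` {v. v < n \<and> m1 8 v 0 = 1}"
          "length trw \<le> cost n write_chosen" "same_except {12} m1 m2"
        using exec_write_chosen[of m1 n] c(5) by (auto simp: tables_def)
      have written: "{x. Written x \<in> set trw} = lab ` chosen m1"
        unfolding w(3) chosen_def using lab1 by (intro image_cong) auto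
      have t2: "tables m2" "chosen m2 = chosen m1"
        using tables_cong[OF w(5)] c(5) by simp_all
      obtain tra m3 where a: "exec advance m2 tra m3" "set tra \<subseteq> {Tick}" "length tra \<le> cost n advance"
          "same_except {8, 9, 10, 11, 20, 21, 22, 23, 24, 25, 26} m2 m3" "tables m3"
          "m3 10 0 0 = 0 \<and> later n (chosen m1) = {} \<or> (\<exists>k\<le>n. m3 10 0 0 = Suc k \<and>
            good k (chosen m3) \<and> pending k (chosen m3) = later n (chosen m1))"
        using wp_sound[OF wp_advance[OF t2(1)]] t2(2) by auto
      let ?X = "chosen m1" and ?R = "later n (chosen m1)"
      have R_eq: "R = insert ?X ?R" using pending_n[OF c(6)] c(7) by simp
      have lab3: "m3 2 v 0 = lab v" if "v < n" for v
        using same_exceptD[OF a(4), of 2] same_exceptD[OF w(5), of 2] lab1[OF that] by simp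
      \<comment> \<open>The set just output is not later than itself, so the pending set
        shrinks.\<close>
      have "card ?R < card R"
        using R_eq less.prems(1) notin_later[of ?X n] by simp
      moreover have "finite ?R" "?R \<subseteq> solutions" using R_eq less.prems by auto
      ultimately obtain tr m' where IH: "exec enumerate_loop m3 tr m'" "distinct (outputs tr)"
          "set (outputs tr) = (`) lab ` ?R" "hd (delays tr) \<le> round_cost n"
          "\<forall>d\<in>set (delays tr). d \<le> 2 * round_cost n"
        using less.hyps[of ?R m3] a(5,6) lab3 by blast
      have "exec (complete_prefix ;; write_chosen ;; Emit ;; advance) m (trc @ trw @ [Emitted] @ tra) m3"
        by (rule exec.Seq[OF c(1) exec.Seq[OF w(1) exec.Seq[OF exec.Emit a(1)]]])
      then have "exec enumerate_loop m (Tick # (trc @ trw @ [Emitted] @ tra) @ tr) m'"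
        using k(2) IH(1) unfolding enumerate_loop_def by (intro exec.WhileTrue) simp_all
      then have run: "exec enumerate_loop m ((Tick # trc @ trw) @ Emitted # tra @ tr) m'" by simp
      have pre: "Emitted \<notin> set (Tick # trc @ trw)" using c(2) w(2) by auto
      have "{x. Written x \<in> set (Tick # trc @ trw)} = lab ` ?X"
        using c(2) written by auto
      then have out: "outputs ((Tick # trc @ trw) @ Emitted # tra @ tr) = lab ` ?X # outputs tr"
        using outputs_append_Emitted[OF pre] outputs_append_quiet[OF a(2)] by simp
      have del: "delays ((Tick # trc @ trw) @ Emitted # tra @ tr)
          = Suc (length (Tick # trc @ trw)) # (length tra + hd (delays tr)) # tl (delays tr)"
        using delays_append_Emitted[OF pre] delays_append_quiet[OF a(2)] by simp
      have "lab ` ?X \<notin> (`) lab ` ?R"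
      proof
        assume "lab ` ?X \<in> (`) lab ` ?R"
        then obtain Y where Y: "Y \<in> ?R" "lab ` ?X = lab ` Y" by auto
        then have "Y \<subseteq> {..<n}" using \<open>?R \<subseteq> solutions\<close> by (auto simp: solutions_def)
        then have "?X = Y" using inj_on_image_eq_iff[OF inj] Y(2) chosen_subset[of m1] by blast
        then show False using Y(1) notin_later by blast
      qed
      then have "distinct (outputs ((Tick # trc @ trw) @ Emitted # tra @ tr))"
          "set (outputs ((Tick # trc @ trw) @ Emitted # tra @ tr)) = (`) lab ` R"
        unfolding out R_eq using IH(2,3) by auto
      moreover have "set (tl (delays tr)) \<subseteq> set (delays tr)"
        by (cases "delays tr") auto
      then have "hd (delays ((Tick # trc @ trw) @ Emitted # tra @ tr)) \<le> round_cost n"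
        "\<forall>d\<in>set (delays ((Tick # trc @ trw) @ Emitted # tra @ tr)). d \<le> 2 * round_cost n"
        unfolding del using IH(4,5) c(3) w(4) a(3) by (auto simp: round_cost_def)
      ultimately show ?thesis using run by blast
    qed
  qed
qed

end

section \<open>Tables\<close>

text \<open>Halving by counting alone: scalar \<open>17\<close> is a parity bit, and every second
  neighbour increments the entry in array \<open>5\<close>. Scalar \<open>18\<close> counts feasible
  children.\<close>

definition tally_children :: com where
  "tally_children = For 15
     (IfElse (Equal (entry 3 (scalar 15)) (scalar 16))
       (IfElse (Equal (scalar 17) (Const 1))
          (set_scalar 17 (Const 0) ;; set_entry 5 (scalar 16) (Inc (entry 5 (scalar 16))))
          (set_scalar 17 (Const 1)) ;;
        IfElse (Equal (entry 6 (scalar 15)) (Const 1)) (set_scalar 18 (Inc (scalar 18))) Skip)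
       Skip)"

text \<open>Scalar \<open>16\<close> runs downwards from \<open>n - 1\<close>, so the children of a
  vertex are finished before it. For every vertex but the root the parity bit starts at 1, which
  counts the parent.\<close>

definition tabulate :: com where
  "tabulate =
     set_scalar 16 (scalar 0) ;;
     For 14
      (set_scalar 16 (Dec (scalar 16)) ;;
       set_scalar 18 (Const 0) ;;
       IfElse (Equal (scalar 16) (Const 0)) (set_scalar 17 (Const 0)) (set_scalar 17 (Const 1)) ;;
       tally_children ;;
       IfElse (Conj (Less (Const 0) (entry 5 (scalar 16)))
           (Neg (Less (Inc (scalar 18)) (entry 5 (scalar 16)))))
         (set_entry 6 (scalar 16) (Const 1)) Skip ;;
       IfElse (Neg (Less (scalar 18) (entry 5 (scalar 16))))
         (set_entry 7 (scalar 16) (Const 1)) Skip)"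

context rooted_tree
begin

lemma wp_tally_children:
  assumes m: "m 0 0 0 = n" "\<And>v. v < n \<Longrightarrow> m 3 v 0 = par v" "m 16 0 0 = i" "m 5 i 0 = 0"
      "m 17 0 0 = (if i = 0 then 0 else 1)" "m 18 0 0 = 0"
    and feas: "\<And>c. c \<in> children i \<Longrightarrow> m 6 c 0 = 1 \<longleftrightarrow> feasible c"
  shows "wp n tally_children (\<lambda>m'. same_except {5, 15, 17, 18} m m' \<and>
    (\<forall>v. v \<noteq> i \<longrightarrow> m' 5 v 0 = m 5 v 0) \<and> m' 5 i 0 = half i \<and>
    m' 18 0 0 = card {c \<in> children i. feasible c}) m"
proof -
  \<comment> \<open>The part of the degree of \<open>i\<close> seen before position
    \<open>j\<close>, with the parent counted in advance.\<close>
  define d where "d j = card {c. c < j \<and> par c = i} + (if i = 0 then 0 else 1)" for j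
  define I where "I j m' \<longleftrightarrow> same_except {5, 15, 17, 18} m m' \<and> (\<forall>v. v \<noteq> i \<longrightarrow> m' 5 v 0 = m 5 v 0) \<and>
      m' 5 i 0 = d j div 2 \<and> m' 17 0 0 = d j mod 2 \<and>
      m' 18 0 0 = card {c. c < j \<and> par c = i \<and> feasible c}" for j m'
  have d_Suc: "d (Suc j) = (if par j = i then Suc (d j) else d j)" for j
    by (simp add: d_def card_less_Suc)
  show ?thesis
    unfolding tally_children_def
  proof (rule wp_For[where I = I])
    show "m 0 0 0 = n" by (rule m)
    show "I 0 (update m 15 0 0 0)"
      using m by (simp add: I_def d_def)
  next
    fix j m' assume j: "j < n" "I j m'" "m' 0 0 0 = n" "m' 15 0 0 = j"
    have same: "same_except {5, 15, 17, 18} m m'" using j by (simp add: I_def)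
    have vals: "m' 3 j 0 = par j" "m' 16 0 0 = i" "m' 6 j 0 = m 6 j 0"
      using same_exceptD[OF same] m j(1) by simp_all
    have f: "m 6 j 0 = 1 \<longleftrightarrow> feasible j" if "par j = i"
      using feas[of j] j(1) that by (simp add: children_def)
    have odd: "Suc (d j) div 2 = Suc (d j div 2) \<and> Suc (d j) mod 2 = 0" if "d j mod 2 = 1"
      using that by presburger
    have even: "Suc (d j) div 2 = d j div 2 \<and> Suc (d j) mod 2 = 1" if "d j mod 2 \<noteq> 1"
      using that by presburger
    let ?P = "\<lambda>m'. m' 0 0 0 = n \<and> m' 15 0 0 = j \<and> I (Suc j) (update m' 15 0 0 (Suc j))"
    consider "par j \<noteq> i" | "par j = i" "d j mod 2 = 1" | "par j = i" "d j mod 2 \<noteq> 1" by blast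
    then show "wp n (IfElse (Equal (entry 3 (scalar 15)) (scalar 16))
       (IfElse (Equal (scalar 17) (Const 1))
          (set_scalar 17 (Const 0) ;; set_entry 5 (scalar 16) (Inc (entry 5 (scalar 16))))
          (set_scalar 17 (Const 1)) ;;
        IfElse (Equal (entry 6 (scalar 15)) (Const 1)) (set_scalar 18 (Inc (scalar 18))) Skip)
       Skip) ?P m'"
    proof cases
      case 1
      then show ?thesis using j(2-4) vals unfolding I_def card_less_Suc d_Suc by simp
    next
      case 2
      then show ?thesis
        using j(2-4) vals f odd unfolding I_def card_less_Suc d_Suc by simp
    next
      case 3
      then show ?thesis
        using j(2-4) vals f even unfolding I_def card_less_Suc d_Suc by simp
    qed
  next
    fix m' assume I: "I n m'"
    have "d n div 2 = half i"
      by (simp add: d_def half_def children_def)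
    moreover have "{c. c < n \<and> par c = i \<and> feasible c} = {c \<in> children i. feasible c}"
      by (auto simp: children_def)
    ultimately show "same_except {5, 15, 17, 18} m m' \<and> (\<forall>v. v \<noteq> i \<longrightarrow> m' 5 v 0 = m 5 v 0) \<and>
        m' 5 i 0 = half i \<and> m' 18 0 0 = card {c \<in> children i. feasible c}"
      using I by (simp add: I_def)
  qed auto
qed

lemma wp_tabulate:
  assumes m: "m 0 0 0 = n" "\<And>v. v < n \<Longrightarrow> m 3 v 0 = par v"
    "\<And>v. m 5 v 0 = 0" "\<And>v. m 6 v 0 = 0" "\<And>v. m 7 v 0 = 0" "m 8 n 0 = 0"
  shows "wp n tabulate (\<lambda>m'. same_except {5, 6, 7, 14, 15, 16, 17, 18} m m' \<and> tables m') m"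
proof -
  let ?A = "{5, 6, 7, 14, 15, 16, 17, 18} :: nat set"
  define ok where "ok m' v \<longleftrightarrow> m' 5 v 0 = half v \<and> (m' 6 v 0 = 1 \<longleftrightarrow> feasible v) \<and>
      (m' 7 v 0 = 1 \<longleftrightarrow> startable v)" for m' :: memory and v
  \<comment> \<open>After \<open>q\<close> rounds the positions from \<open>n - q\<close> on are
    final. The others must still be 0, since array \<open>5\<close> is incremented in place and
    flags are only ever set.\<close>
  define I where "I q m' \<longleftrightarrow> same_except ?A m m' \<and> m' 16 0 0 = n - q \<and>
      (\<forall>v<n. if v < n - q then m' 5 v 0 = 0 \<and> m' 6 v 0 = 0 \<and> m' 7 v 0 = 0 else ok m' v)"
    for q m'
  let ?flags = "IfElse (Conj (Less (Const 0) (entry 5 (scalar 16)))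
           (Neg (Less (Inc (scalar 18)) (entry 5 (scalar 16)))))
         (set_entry 6 (scalar 16) (Const 1)) Skip ;;
       IfElse (Neg (Less (scalar 18) (entry 5 (scalar 16))))
         (set_entry 7 (scalar 16) (Const 1)) Skip"
  let ?post = "\<lambda>m'. same_except ?A m m' \<and> tables m'"
  have "wp n (For 14 (set_scalar 16 (Dec (scalar 16)) ;; set_scalar 18 (Const 0) ;;
       IfElse (Equal (scalar 16) (Const 0)) (set_scalar 17 (Const 0)) (set_scalar 17 (Const 1)) ;;
       tally_children ;; ?flags)) ?post (update m 16 0 0 n)"
  proof (rule wp_For[where I = I])
    show "update m 16 0 0 n 0 0 0 = n" using m by simp
    show "I 0 (update (update m 16 0 0 n) 14 0 0 0)"
      using m by (simp add: I_def)
  next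
    fix m' assume I: "I n m'"
    then have same: "same_except ?A m m'" by (simp add: I_def)
    show "?post m'"
      using I same_exceptD[OF same] m by (simp add: I_def ok_def tables_def)
  next
    fix q m' assume q: "q < n" "I q m'" "m' 0 0 0 = n" "m' 14 0 0 = q"
    define i where "i = n - Suc q"
    have i: "i < n" "n - q = Suc i" using q(1) by (auto simp: i_def)
    let ?Q = "\<lambda>m'. m' 0 0 0 = n \<and> m' 14 0 0 = q \<and> I (Suc q) (update m' 14 0 0 (Suc q))"
    define m1 where "m1 = update (update (update m' 16 0 0 i) 18 0 0 0) 17 0 0 (if i = 0 then 0 else 1)"
    have same: "same_except ?A m m'" and i16: "m' 16 0 0 = Suc i"
      and processed: "\<And>v. v < n \<Longrightarrow> i < v \<Longrightarrow> ok m' v"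
      and todo: "\<And>v. v \<le> i \<Longrightarrow> m' 5 v 0 = 0 \<and> m' 6 v 0 = 0 \<and> m' 7 v 0 = 0"
      using q(2) i by (auto simp: I_def)
    have same1: "same_except ?A m m1" using same by (simp add: m1_def)
    have ok1: "ok m1 v = ok m' v" for v by (simp add: ok_def m1_def)
    have "wp n tally_children (\<lambda>m2. same_except {5, 15, 17, 18} m1 m2 \<and>
        (\<forall>v. v \<noteq> i \<longrightarrow> m2 5 v 0 = m1 5 v 0) \<and> m2 5 i 0 = half i \<and>
        m2 18 0 0 = card {c \<in> children i. feasible c}) m1"
    proof (rule wp_tally_children)
      show "m1 3 v 0 = par v" if "v < n" for v
        using same_exceptD[OF same1, of 3] m that by simp
      show "m1 6 c 0 = 1 \<longleftrightarrow> feasible c" if "c \<in> children i" for c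
        using processed[of c] children_greater[OF i(1) that] that ok1[of c]
        by (simp add: ok_def children_def)
    qed (use q todo[of i] in \<open>simp_all add: m1_def\<close>)
    then have "wp n tally_children (wp n ?flags ?Q) m1"
    proof (rule wp_mono)
      fix m2
      assume post: "same_except {5, 15, 17, 18} m1 m2 \<and>
        (\<forall>v. v \<noteq> i \<longrightarrow> m2 5 v 0 = m1 5 v 0) \<and> m2 5 i 0 = half i \<and>
        m2 18 0 0 = card {c \<in> children i. feasible c}"
      note frame = conjunct1[OF post]
      have same2: "same_except ?A m m2"
        using same_except_trans[OF same1 frame, of ?A] by simp
      have vals: "m2 0 0 0 = n" "m2 14 0 0 = q" "m2 16 0 0 = i"
        using same_exceptD[OF frame] q by (simp_all add: m1_def)
      have flags: "m2 6 v 0 = m' 6 v 0" "m2 7 v 0 = m' 7 v 0" for v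
        using same_exceptD[OF frame] by (simp_all add: m1_def)
      have half2: "m2 5 v 0 = (if v = i then half i else m' 5 v 0)" for v
        using post by (simp add: m1_def)
      have count: "m2 18 0 0 = card {c \<in> children i. feasible c}" using post by simp
      have others: "v \<noteq> i \<longrightarrow> (if v < i then m' 5 v 0 = 0 \<and> m' 6 v 0 = 0 \<and> m' 7 v 0 = 0 else ok m' v)" if "v < n" for v
        using processed[OF that] todo[of v] by simp
      have zero: "m' 6 i 0 = 0" "m' 7 i 0 = 0" using todo[of i] by simp_all
      have feas: "feasible i \<longleftrightarrow> 0 < half i \<and> \<not> card {c \<in> children i. feasible c} + 1 < half i"
        "startable i \<longleftrightarrow> \<not> card {c \<in> children i. feasible c} < half i"
        using feasible_iff[OF i(1)] by (auto simp: startable_def not_less)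
      have I: "I (Suc q) m3"
        if "same_except ?A m m3" "m3 16 0 0 = i" "\<And>v. m3 5 v 0 = m2 5 v 0"
          "\<And>v. v \<noteq> i \<Longrightarrow> m3 6 v 0 = m' 6 v 0" "\<And>v. v \<noteq> i \<Longrightarrow> m3 7 v 0 = m' 7 v 0"
          "m3 6 i 0 = 1 \<longleftrightarrow> feasible i" "m3 7 i 0 = 1 \<longleftrightarrow> startable i" for m3
        unfolding I_def
      proof (intro conjI allI impI)
        show "m3 16 0 0 = n - Suc q" using that i_def by simp
        fix v assume "v < n"
        show "if v < n - Suc q then m3 5 v 0 = 0 \<and> m3 6 v 0 = 0 \<and> m3 7 v 0 = 0 else ok m3 v"
          using others[OF \<open>v < n\<close>] that half2 unfolding i_def[symmetric]
          by (cases "v = i") (simp_all add: ok_def split: if_splits)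
      qed (rule that)
      show "wp n ?flags ?Q m2"
      proof -
        have iffs: "0 < half i \<and> \<not> card {c \<in> children i. feasible c} + 1 < half i \<longleftrightarrow> feasible i"
            "\<not> card {c \<in> children i. feasible c} < half i \<longleftrightarrow> startable i"
          using feas by blast+
        define m3 where "m3 = (if feasible i then update m2 6 i 0 1 else m2)"
        define m4 where "m4 = (if startable i then update m3 7 i 0 1 else m3)"
        have "wp n (IfElse (Conj (Less (Const 0) (entry 5 (scalar 16)))
            (Neg (Less (Inc (scalar 18)) (entry 5 (scalar 16)))))
          (set_entry 6 (scalar 16) (Const 1)) Skip) R m2 = R m3" for R
          by (simp add: vals half2 count iffs m3_def del: One_nat_def)
        moreover have "wp n (IfElse (Neg (Less (scalar 18) (entry 5 (scalar 16))))
          (set_entry 7 (scalar 16) (Const 1)) Skip) R m3 = R m4" for R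
        proof -
          have "m3 16 0 0 = i" "m3 5 i 0 = half i" "m3 18 0 0 = card {c \<in> children i. feasible c}"
            by (simp_all add: m3_def vals half2 count)
          then show ?thesis by (simp add: iffs m4_def)
        qed
        moreover have "m4 0 0 0 = n" "m4 14 0 0 = q"
          by (simp_all add: m4_def m3_def vals)
        moreover have "I (Suc q) (update m4 14 0 0 (Suc q))"
          by (rule I) (simp_all add: m4_def m3_def same2 vals flags zero)
        ultimately show ?thesis by (simp only: wp.simps(5) simp_thms)
      qed
    qed
    then show "wp n (set_scalar 16 (Dec (scalar 16)) ;; set_scalar 18 (Const 0) ;;
       IfElse (Equal (scalar 16) (Const 0)) (set_scalar 17 (Const 0)) (set_scalar 17 (Const 1)) ;;
       tally_children ;; ?flags) ?Q m'"
      using i16 by (cases "i = 0") (simp_all add: m1_def)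
  qed auto
  then show ?thesis using m(1) by (simp add: tabulate_def)
qed

end

section \<open>Rooting the tree\<close>

text \<open>If the vertex to be prepended already occurs, only the suffix from that occurrence is
  kept.\<close>

lemma rtrancl_simple_path:
  assumes "(a, b) \<in> R\<^sup>*"
  shows "\<exists>xs. xs \<noteq> [] \<and> hd xs = a \<and> last xs = b \<and> distinct xs \<and>
    successively (\<lambda>x y. (x, y) \<in> R) xs"
  using assms
proof (induction rule: converse_rtrancl_induct)
  case base
  then show ?case by (intro exI[of _ "[b]"]) simp
next
  case (step x y)
  then obtain xs where xs: "xs \<noteq> []" "hd xs = y" "last xs = b" "distinct xs"
    "successively (\<lambda>x y. (x, y) \<in> R) xs" by blast
  show ?case
  proof (cases "x \<in> set xs")
    case True
    then obtain ys zs where "xs = ys @ x # zs" by (meson split_list)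
    then show ?thesis
      using xs by (intro exI[of _ "x # zs"]) (auto simp: successively_append_iff)
  next
    case False
    then show ?thesis
      using xs step.hyps(1)
      by (intro exI[of _ "x # xs"]) (auto simp: successively_Cons)
  qed
qed

text \<open>Otherwise a simple path in \<open>F\<close> from \<open>a\<close> to \<open>b\<close>
  and the edge between them close a cycle in \<open>E\<close>. The path has at least three vertices,
  because its ends differ and are not joined in \<open>F\<close>.\<close>

lemma acyclic_reachable_edge:
  assumes E: "\<And>xs. \<not> graph_cycle E xs" and F: "F \<subseteq> E"
    and path: "(a, b) \<in> {(x, y). {x, y} \<in> F}\<^sup>*" and ab: "{a, b} \<in> E" "a \<noteq> b"
  shows "{a, b} \<in> F"
proof (rule ccontr)
  assume notF: "{a, b} \<notin> F"
  obtain xs where xs: "xs \<noteq> []" "hd xs = a" "last xs = b" "distinct xs"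
    "successively (\<lambda>x y. (x, y) \<in> {(x, y). {x, y} \<in> F}) xs"
    using rtrancl_simple_path[OF path] by blast
  have step: "{xs ! i, xs ! Suc i} \<in> F" if "Suc i < length xs" for i
    using xs(5) that by (auto simp: successively_conv_nth)
  have ends: "xs ! 0 = a" "xs ! (length xs - 1) = b"
    using xs by (simp_all add: hd_conv_nth last_conv_nth)
  have "length xs \<noteq> 0" "length xs \<noteq> 1"
    using xs(1) ends ab(2) by auto
  moreover have "length xs \<noteq> 2"
    using ends notF step[of 0] by auto
  ultimately have len: "length xs \<ge> 3" by linarith
  have "{xs ! i, xs ! (Suc i mod length xs)} \<in> E" if "i < length xs" for i
  proof (cases "Suc i < length xs")
    case True
    then show ?thesis using step[of i] F by auto
  next
    case False
    then have "Suc i = length xs" using that by simp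
    then have "i = length xs - 1" "Suc i mod length xs = 0" by auto
    then show ?thesis using ends ab(1) by (simp add: insert_commute)
  qed
  then have "graph_cycle E xs"
    using len xs(4) by (simp add: graph_cycle_def)
  then show False using E by blast
qed

text \<open>The parent edges already connect all vertices, so acyclicity leaves no room for another
  edge.\<close>

lemma tree_edges_image:
  assumes tree: "is_tree {..<n} E" and bij: "bij_betw f {..<n} {..<n}"
    and rooted: "rooted_tree n par"
    and edges: "\<And>c. 0 < c \<Longrightarrow> c < n \<Longrightarrow> {f (par c), f c} \<in> E"
  shows "E = (`) ((`) f) (rooted_tree.tree_edges n par)"
proof -
  interpret rooted_tree n par by (rule rooted)
  let ?F = "(`) ((`) f) tree_edges"
  have inF: "{f c, f (par c)} \<in> ?F" if "0 < c" "c < n" for c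
  proof -
    have "{c, par c} \<in> tree_edges" using that by (auto simp: tree_edges_def)
    then have "f ` {c, par c} \<in> ?F" by blast
    then show ?thesis by simp
  qed
  have F: "?F \<subseteq> E"
    using edges by (auto simp: tree_edges_def insert_commute)
  let ?R = "{(x, y). {x, y} \<in> ?F}"
  have reach: "(f c, f 0) \<in> ?R\<^sup>*" if "c < n" for c
    using that
  proof (induction c rule: less_induct)
    case (less c)
    show ?case
    proof (cases "c = 0")
      case False
      then have "(f c, f (par c)) \<in> ?R" using inF[of c] less.prems by simp
      moreover have "(f (par c), f 0) \<in> ?R\<^sup>*"
        using less.IH[of "par c"] par_less[of c] False less.prems by simp
      ultimately show ?thesis by (rule converse_rtrancl_into_rtrancl)
    qed simp
  qed
  have "sym ?R" by (auto simp: sym_def insert_commute)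
  then have "sym (?R\<^sup>*)" by (rule sym_rtrancl)
  then have connected: "(f c, f d) \<in> ?R\<^sup>*" if "c < n" "d < n" for c d
    using reach[OF that(1)] reach[OF that(2)] by (meson rtrancl_trans symD)
  have "e \<in> ?F" if e: "e \<in> E" for e
  proof -
    have "e \<subseteq> {..<n}" "card e = 2"
      using tree e by (auto simp: is_tree_def simple_graph_def)
    then obtain a b where ab: "e = {a, b}" "a \<noteq> b" "a < n" "b < n"
      by (auto simp: card_2_iff)
    then obtain c d where "a = f c" "b = f d" "c < n" "d < n"
      using bij by (metis bij_betw_imp_surj_on imageE lessThan_iff)
    then have "(a, b) \<in> ?R\<^sup>*" using connected by blast
    then show ?thesis
      using acyclic_reachable_edge[of E ?F a b] tree F e ab by (auto simp: is_tree_def)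
  qed
  then show ?thesis using F by blast
qed

section \<open>Transport of alliances along a renaming of the vertices\<close>

lemma deg_in_image:
  assumes inj: "inj_on f V" and E: "E \<subseteq> Pow V" and X: "X \<subseteq> V" and v: "v \<in> V"
  shows "deg_in ((`) ((`) f) E) (f ` X) (f v) = deg_in E X v"
proof -
  have "{f v, f u} \<in> (`) ((`) f) E \<longleftrightarrow> {v, u} \<in> E" if "u \<in> X" for u
  proof
    assume "{f v, f u} \<in> (`) ((`) f) E"
    then obtain e where e: "e \<in> E" "f ` {v, u} = f ` e" by auto
    then have "{v, u} = e"
      using inj_on_image_eq_iff[OF inj, of "{v, u}" e] E e(1) X v that by auto
    then show "{v, u} \<in> E" using e by simp
  next
    assume "{v, u} \<in> E"
    then have "f ` {v, u} \<in> (`) ((`) f) E" by blast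
    then show "{f v, f u} \<in> (`) ((`) f) E" by simp
  qed
  then have "{u \<in> f ` X. {f v, u} \<in> (`) ((`) f) E} = f ` {u \<in> X. {v, u} \<in> E}"
    by auto
  moreover have "inj_on f {u \<in> X. {v, u} \<in> E}"
    using inj X by (auto intro: inj_on_subset)
  ultimately show ?thesis by (simp add: deg_in_def card_image)
qed

lemma defensive_alliance_image:
  assumes "inj_on f V" "E \<subseteq> Pow V" "A \<subseteq> V"
  shows "defensive_alliance (f ` V) ((`) ((`) f) E) (f ` A) \<longleftrightarrow> defensive_alliance V E A"
proof -
  have "f ` V - f ` A = f ` (V - A)"
    using assms by (simp add: inj_on_image_set_diff[of f V])
  then show ?thesis
    using assms deg_in_image[OF assms(1,2)] unfolding defensive_alliance_def
    by (auto simp: subset_iff)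
qed

lemma globally_minimal_image:
  assumes inj: "inj_on f V" and E: "E \<subseteq> Pow V" and A: "A \<subseteq> V"
  shows "globally_minimal_defensive_alliance (f ` V) ((`) ((`) f) E) (f ` A) \<longleftrightarrow>
    globally_minimal_defensive_alliance V E A"
proof -
  have iff: "(\<exists>B'\<subset>f ` A. B' \<noteq> {} \<and> defensive_alliance (f ` V) ((`) ((`) f) E) B') \<longleftrightarrow>
      (\<exists>B\<subset>A. B \<noteq> {} \<and> defensive_alliance V E B)"
  proof
    assume "\<exists>B'\<subset>f ` A. B' \<noteq> {} \<and> defensive_alliance (f ` V) ((`) ((`) f) E) B'"
    then obtain B where B: "B \<subseteq> A" "f ` B \<subset> f ` A" "B \<noteq> {}"
        "defensive_alliance (f ` V) ((`) ((`) f) E) (f ` B)"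
      by (metis image_is_empty psubset_imp_subset subset_imageE)
    then have "B \<subset> A" by auto
    then show "\<exists>B\<subset>A. B \<noteq> {} \<and> defensive_alliance V E B"
      using B defensive_alliance_image[OF inj E, of B] A by blast
  next
    assume "\<exists>B\<subset>A. B \<noteq> {} \<and> defensive_alliance V E B"
    then obtain B where B: "B \<subset> A" "B \<noteq> {}" "defensive_alliance V E B" by blast
    then have "f ` B \<subset> f ` A"
      using image_strict_mono[OF inj_on_subset[OF inj A]] by simp
    then show "\<exists>B'\<subset>f ` A. B' \<noteq> {} \<and> defensive_alliance (f ` V) ((`) ((`) f) E) B'"
      using B defensive_alliance_image[OF inj E, of B] A by (intro exI[of _ "f ` B"]) auto
  qed
  show ?thesis
    using iff defensive_alliance_image[OF inj E A]
    unfolding globally_minimal_defensive_alliance_def by simp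
qed

lemma globally_minimal_set_image:
  assumes inj: "inj_on f V" and E: "E \<subseteq> Pow V"
  shows "{A. globally_minimal_defensive_alliance (f ` V) ((`) ((`) f) E) A} =
    (`) f ` {A. globally_minimal_defensive_alliance V E A}"
proof -
  have sub: "A \<subseteq> W" if "globally_minimal_defensive_alliance W F A" for A :: "'c set" and W F
    using that by (auto simp: globally_minimal_defensive_alliance_def defensive_alliance_def)
  show ?thesis
  proof (intro equalityI subsetI)
    fix A assume "A \<in> {A. globally_minimal_defensive_alliance (f ` V) ((`) ((`) f) E) A}"
    moreover obtain B where "B \<subseteq> V" "A = f ` B"
      using sub calculation by (metis mem_Collect_eq subset_imageE)
    ultimately show "A \<in> (`) f ` {A. globally_minimal_defensive_alliance V E A}"
      using globally_minimal_image[OF inj E] by auto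
  next
    fix A assume "A \<in> (`) f ` {A. globally_minimal_defensive_alliance V E A}"
    then obtain B where B: "A = f ` B" "globally_minimal_defensive_alliance V E B" by blast
    then have "B \<subseteq> V"
      by (auto simp: globally_minimal_defensive_alliance_def defensive_alliance_def)
    then show "A \<in> {A. globally_minimal_defensive_alliance (f ` V) ((`) ((`) f) E) A}"
      using globally_minimal_image[OF inj E, of B] B by simp
  qed
qed

section \<open>Breadth-first numbering of the vertices\<close>

definition visit_neighbour :: com where
  "visit_neighbour =
     IfElse (Conj (Equal (Entry 1 (entry 2 (scalar 14)) (scalar 15)) (Const 1))
         (Equal (entry 4 (scalar 15)) (Const 0)))
       (set_entry 2 (scalar 13) (scalar 15) ;; set_entry 3 (scalar 13) (scalar 14) ;;
        set_entry 4 (scalar 15) (Const 1) ;; set_scalar 13 (Inc (scalar 13)))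
       Skip"

text \<open>Array \<open>2\<close> is the search queue and scalar \<open>13\<close> its length, so
  positions are numbered by discovery and parents precede children. All entries start at 0, hence
  position 0 already holds vertex 0.\<close>

definition order_vertices :: com where
  "order_vertices =
     set_entry 3 (Const 0) (scalar 0) ;; set_entry 4 (Const 0) (Const 1) ;;
     set_scalar 13 (Const 1) ;; For 14 (For 15 visit_neighbour)"

text \<open>The pair \<open>(q, j)\<close> is the next adjacency test, for position \<open>q\<close>
  and vertex \<open>j\<close>; the last conjunct records the effect of all earlier tests.\<close>

definition order_inv :: "nat \<Rightarrow> nat set set \<Rightarrow> nat \<Rightarrow> nat \<Rightarrow> memory \<Rightarrow> bool" where
  "order_inv n E q j m \<longleftrightarrow>
     same_except {2, 3, 4, 13, 14, 15} (graph_input n E) m \<and> 0 < m 13 0 0 \<and>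
     inj_on (\<lambda>i. m 2 i 0) {..<m 13 0 0} \<and> (\<forall>i<m 13 0 0. m 2 i 0 < n) \<and> m 3 0 0 = n \<and>
     (\<forall>c. 0 < c \<longrightarrow> c < m 13 0 0 \<longrightarrow> m 3 c 0 < c \<and> {m 2 (m 3 c 0) 0, m 2 c 0} \<in> E) \<and>
     (\<forall>v<n. m 4 v 0 = 0 \<longleftrightarrow> (\<forall>i<m 13 0 0. m 2 i 0 \<noteq> v)) \<and>
     (\<forall>i<m 13 0 0. \<forall>v<n. i < q \<or> i = q \<and> v < j \<longrightarrow> {m 2 i 0, v} \<in> E \<longrightarrow> m 4 v 0 \<noteq> 0)"

lemma order_inv_indices:
  assumes "order_inv n E q j m"
    and "\<And>i v. i < m 13 0 0 \<Longrightarrow> v < n \<Longrightarrow> i < q' \<or> i = q' \<and> v < j' \<Longrightarrow> {m 2 i 0, v} \<in> E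
      \<Longrightarrow> m 4 v 0 \<noteq> 0"
  shows "order_inv n E q' j' m"
proof -
  have "\<forall>i<m 13 0 0. \<forall>v<n. i < q' \<or> i = q' \<and> v < j' \<longrightarrow> {m 2 i 0, v} \<in> E \<longrightarrow> m 4 v 0 \<noteq> 0"
    by (intro allI impI) (rule assms(2))
  then show ?thesis using assms(1) unfolding order_inv_def by - (elim conjE, (intro conjI; assumption))
qed

lemma order_inv_update:
  assumes "a \<in> {14, 15}"
  shows "order_inv n E q j (update m a 0 0 x) = order_inv n E q j m"
proof -
  have a: "a \<noteq> 2" "a \<noteq> 3" "a \<noteq> 4" "a \<noteq> 13" using assms by auto
  have "same_except {2, 3, 4, 13, 14, 15} (graph_input n E) (update m a 0 0 x) =
      same_except {2, 3, 4, 13, 14, 15} (graph_input n E) m"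
    using assms unfolding same_except_def by (metis insertCI update_other)
  then show ?thesis using a unfolding order_inv_def by simp
qed

lemma order_inv_card:
  assumes "order_inv n E q j m"
  shows "m 13 0 0 \<le> n"
proof -
  have "card ((\<lambda>i. m 2 i 0) ` {..<m 13 0 0}) \<le> card {..<n}"
    using assms by (intro card_mono) (auto simp: order_inv_def)
  then show ?thesis
    using assms by (simp add: order_inv_def card_image)
qed

text \<open>If the scan has caught up with the queue, the queued vertices are closed under
  adjacency, and by connectedness they are all vertices. So none of the \<open>n\<close> rounds
  reads a position that is not yet filled.\<close>

lemma order_inv_progress:
  assumes inv: "order_inv n E q 0 m" and tree: "is_tree {..<n} E"
  shows "q < m 13 0 0 \<or> m 13 0 0 = n"
proof (rule disjCI)
  let ?S = "(\<lambda>i. m 2 i 0) ` {..<m 13 0 0}"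
  assume "m 13 0 0 \<noteq> n"
  show "q < m 13 0 0"
  proof (rule ccontr)
    assume q: "\<not> q < m 13 0 0"
    have in_S: "v \<in> ?S \<longleftrightarrow> m 4 v 0 \<noteq> 0" if "v < n" for v
      using inv that by (auto simp: order_inv_def)
    have S: "?S \<subseteq> {..<n}" using inv by (auto simp: order_inv_def)
    have closed: "v \<in> ?S" if u: "u \<in> ?S" and uv: "{u, v} \<in> E" for u v
    proof -
      have v: "v < n"
        using tree uv by (auto simp: is_tree_def simple_graph_def)
      obtain i where i: "i < m 13 0 0" "u = m 2 i 0" using u by auto
      then have "i < q" using q by simp
      then have "m 4 v 0 \<noteq> 0"
        using inv i v uv unfolding order_inv_def by blast
      then show ?thesis using in_S[OF v] by simp
    qed
    have "0 < m 13 0 0" using inv by (simp add: order_inv_def)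
    then have start: "m 2 0 0 \<in> ?S" by simp
    have "v \<in> ?S" if "v < n" for v
    proof -
      have "(m 2 0 0, v) \<in> {(x, y). {x, y} \<in> E}\<^sup>*"
        using tree that start S by (auto simp: is_tree_def graph_connected_def)
      then show ?thesis
        by (induction rule: rtrancl_induct) (use start closed in auto)
    qed
    then have "?S = {..<n}" using S by auto
    moreover have "card ?S = m 13 0 0"
      using inv by (simp add: order_inv_def card_image)
    ultimately show False using \<open>m 13 0 0 \<noteq> n\<close> by simp
  qed
qed

lemma wp_visit_neighbour:
  assumes inv: "order_inv n E q j m" and q: "q < m 13 0 0" and j: "j < n"
    and idx: "m 14 0 0 = q" "m 15 0 0 = j"
  shows "wp N visit_neighbour (\<lambda>m'. m' 0 0 0 = n \<and> m' 14 0 0 = q \<and> m' 15 0 0 = j \<and>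
    q < m' 13 0 0 \<and> order_inv n E q (Suc j) (update m' 15 0 0 (Suc j))) m"
proof -
  have same: "same_except {2, 3, 4, 13, 14, 15} (graph_input n E) m"
    using inv by (simp add: order_inv_def)
  have m: "m 0 0 0 = n" "\<And>u v. m 1 u v = 1 \<longleftrightarrow> {u, v} \<in> E"
    using same_exceptD[OF same] by (simp_all add: graph_input_def)
  define k where "k = m 13 0 0"
  show ?thesis
  proof (cases "{m 2 q 0, j} \<in> E \<and> m 4 j 0 = 0")
    case True
    let ?m = "update (update (update (update m 2 k 0 j) 3 k 0 q) 4 j 0 1) 13 0 0 (Suc k)"
    let ?m' = "update ?m 15 0 0 (Suc j)"
    have k: "0 < k" "q < k" using q by (auto simp: k_def)
    have vals: "?m' 2 i 0 = (if i = k then j else m 2 i 0)" "?m' 3 i 0 = (if i = k then q else m 3 i 0)"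
        "?m' 4 i 0 = (if i = j then 1 else m 4 i 0)" "?m' 13 0 0 = Suc k" for i
      by simp_all
    have inj: "inj_on (\<lambda>i. m 2 i 0) {..<k}" and range: "\<And>i. i < k \<Longrightarrow> m 2 i 0 < n"
      and root: "m 3 0 0 = n"
      and parent: "\<And>c. 0 < c \<Longrightarrow> c < k \<Longrightarrow> m 3 c 0 < c \<and> {m 2 (m 3 c 0) 0, m 2 c 0} \<in> E"
      and mark: "\<And>v. v < n \<Longrightarrow> m 4 v 0 = 0 \<longleftrightarrow> (\<forall>i<k. m 2 i 0 \<noteq> v)"
      and visited: "\<And>i v. i < k \<Longrightarrow> v < n \<Longrightarrow> i < q \<or> i = q \<and> v < j \<Longrightarrow> {m 2 i 0, v} \<in> E
        \<Longrightarrow> m 4 v 0 \<noteq> 0"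
      using inv unfolding order_inv_def k_def by blast+
    have new: "m 2 i 0 \<noteq> j" if "i < k" for i
      using mark[OF j] True that by simp
    have "order_inv n E q (Suc j) ?m'"
      unfolding order_inv_def vals
    proof (intro conjI allI impI)
      show "same_except {2, 3, 4, 13, 14, 15} (graph_input n E) ?m'" using same by simp
      show "inj_on (\<lambda>i. if i = k then j else m 2 i 0) {..<Suc k}"
      proof (rule inj_onI)
        fix x y
        assume "x \<in> {..<Suc k}" "y \<in> {..<Suc k}"
          "(if x = k then j else m 2 x 0) = (if y = k then j else m 2 y 0)"
        then show "x = y"
          using new[of x] new[of y] inj_onD[OF inj, of x y] by (auto simp: less_Suc_eq split: if_splits)
      qed
      show "(if v = j then 1 else m 4 v 0) = 0 \<longleftrightarrow> (\<forall>i<Suc k. (if i = k then j else m 2 i 0) \<noteq> v)"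
        if "v < n" for v
        using mark[OF that] by (auto simp: less_Suc_eq)
      show "(if i = k then j else m 2 i 0) < n" if "i < Suc k" for i
        using range[of i] j that by auto
      show "(if 0 = k then q else m 3 0 0) = n" using k root by simp
      show "0 < Suc k" by simp
    next
      \<comment> \<open>Nothing is claimed yet about the neighbours of the new position
        \<open>k\<close>, because \<open>q < k\<close>.\<close>
      fix i v
      assume "i < Suc k" "v < n" "i < q \<or> i = q \<and> v < Suc j" "{if i = k then j else m 2 i 0, v} \<in> E"
      then show "(if v = j then 1 else m 4 v 0) \<noteq> 0"
        using visited[of i v] k by (auto simp: less_Suc_eq)
    next
      fix c assume c: "0 < c" "c < Suc k"
      show "(if c = k then q else m 3 c 0) < c"
        using c k parent[of c] by auto
      show "{if (if c = k then q else m 3 c 0) = k then j else m 2 (if c = k then q else m 3 c 0) 0,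
          if c = k then j else m 2 c 0} \<in> E"
        using c k True parent[of c] by auto
    qed
    moreover have "wp N visit_neighbour Q m = Q ?m" for Q
      using True m idx by (simp add: visit_neighbour_def k_def)
    moreover have "?m 0 0 0 = n" "?m 14 0 0 = q" "?m 15 0 0 = j" "q < ?m 13 0 0"
      using m idx q by (simp_all add: k_def)
    ultimately show ?thesis by simp
  next
    case False
    have "order_inv n E q (Suc j) (update m 15 0 0 (Suc j))"
    proof -
      have "m 4 v 0 \<noteq> 0" if "i < k" "v < n" "i < q \<or> i = q \<and> v < Suc j" "{m 2 i 0, v} \<in> E" for i v
      proof (cases "i = q \<and> v = j")
        case True
        then show ?thesis using False that by simp
      next
        case False
        then have "i < q \<or> i = q \<and> v < j" using that(3) by auto
        then show ?thesis using inv that unfolding order_inv_def k_def by blast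
      qed
      then show ?thesis
        unfolding order_inv_update[OF insertI2, OF insertI1] k_def
        by (intro order_inv_indices[OF inv]) blast
    qed
    moreover have "wp N visit_neighbour Q m = Q m" for Q
      using False m idx by (auto simp: visit_neighbour_def)
    ultimately show ?thesis using m idx q by simp
  qed
qed

lemma wp_order_vertices:
  assumes tree: "is_tree {..<n} E"
  shows "wp n order_vertices (\<lambda>m. order_inv n E n 0 m) (graph_input n E)"
proof -
  let ?m = "update (update (update (graph_input n E) 3 0 0 n) 4 0 0 1) 13 0 0 1"
  have n: "0 < n"
    using tree by (auto simp: is_tree_def graph_connected_def)
  have zero: "graph_input n E 2 i i' = 0" "graph_input n E 4 i i' = 0" for i i'
    by (simp_all add: graph_input_def)
  have n0: "graph_input n E 0 0 0 = n"
    by (simp add: graph_input_def)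
  have "wp n (For 14 (For 15 visit_neighbour)) (order_inv n E n 0) ?m"
  proof (rule wp_For[where I = "\<lambda>q. order_inv n E q 0"])
    show "order_inv n E 0 0 (update ?m 14 0 0 0)"
      using n by (auto simp: order_inv_def zero inj_on_def)
  next
    fix q m assume q: "q < n" "order_inv n E q 0 m" "m 0 0 0 = n" "m 14 0 0 = q"
    have qk: "q < m 13 0 0" using order_inv_progress[OF q(2) tree] q(1) by auto
    show "wp n (For 15 visit_neighbour) (\<lambda>m'. m' 0 0 0 = n \<and> m' 14 0 0 = q \<and>
        order_inv n E (Suc q) 0 (update m' 14 0 0 (Suc q))) m"
    proof (rule wp_For[where I = "\<lambda>j m'. m' 14 0 0 = q \<and> q < m' 13 0 0 \<and> order_inv n E q j m'"])
      show "update m 15 0 0 0 14 0 0 = q \<and> q < update m 15 0 0 0 13 0 0 \<and>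
          order_inv n E q 0 (update m 15 0 0 0)"
        using q qk by (simp add: order_inv_update)
    next
      fix j m' assume "j < n" "m' 14 0 0 = q \<and> q < m' 13 0 0 \<and> order_inv n E q j m'"
        "m' 0 0 0 = n" "m' 15 0 0 = j"
      then show "wp n visit_neighbour (\<lambda>m'. m' 0 0 0 = n \<and> m' 15 0 0 = j \<and>
          update m' 15 0 0 (Suc j) 14 0 0 = q \<and> q < update m' 15 0 0 (Suc j) 13 0 0 \<and>
          order_inv n E q (Suc j) (update m' 15 0 0 (Suc j))) m'"
        by (intro wp_mono[OF wp_visit_neighbour[of n E q j m' n]]) auto
    next
      fix m' assume m': "m' 14 0 0 = q \<and> q < m' 13 0 0 \<and> order_inv n E q n m'" "m' 0 0 0 = n"
      show "m' 0 0 0 = n \<and> m' 14 0 0 = q \<and> order_inv n E (Suc q) 0 (update m' 14 0 0 (Suc q))"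
      proof -
        have "m' 4 v 0 \<noteq> 0" if "i < m' 13 0 0" "v < n" "i < Suc q" "{m' 2 i 0, v} \<in> E" for i v
        proof -
          have "i < q \<or> i = q \<and> v < n" using that by auto
          then show ?thesis using m'(1) that unfolding order_inv_def by blast
        qed
        then have "order_inv n E (Suc q) 0 m'"
          by (intro order_inv_indices[OF conjunct2[OF conjunct2[OF m'(1)]]]) simp
        then show ?thesis using m' by (simp add: order_inv_update)
      qed
    qed (use q in auto)
  qed (use n0 in auto)
  then show ?thesis by (simp add: order_vertices_def n0)
qed

lemma order_inv_result:
  assumes inv: "order_inv n E n 0 m" and tree: "is_tree {..<n} E"
  shows "rooted_tree n (\<lambda>i. m 3 i 0)" "bij_betw (\<lambda>i. m 2 i 0) {..<n} {..<n}"
    "E = (`) ((`) (\<lambda>i. m 2 i 0)) (rooted_tree.tree_edges n (\<lambda>i. m 3 i 0))"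
proof -
  have k: "m 13 0 0 = n"
    using order_inv_progress[OF inv tree] order_inv_card[OF inv] by simp
  have n: "0 < n" using inv k by (simp add: order_inv_def)
  show rooted: "rooted_tree n (\<lambda>i. m 3 i 0)"
    using inv n by unfold_locales (auto simp: order_inv_def k)
  have "inj_on (\<lambda>i. m 2 i 0) {..<n}" "(\<lambda>i. m 2 i 0) ` {..<n} \<subseteq> {..<n}"
    using inv by (auto simp: order_inv_def k)
  then show bij: "bij_betw (\<lambda>i. m 2 i 0) {..<n} {..<n}"
    by (simp add: bij_betw_def endo_inj_surj)
  show "E = (`) ((`) (\<lambda>i. m 2 i 0)) (rooted_tree.tree_edges n (\<lambda>i. m 3 i 0))"
    using inv by (intro tree_edges_image[OF tree bij rooted]) (auto simp: order_inv_def k)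
qed

section \<open>The algorithm\<close>

text \<open>The value 1 in scalar \<open>10\<close> encodes the empty prefix, for which all
  solutions are pending.\<close>

definition build_tables :: com where
  "build_tables = order_vertices ;; tabulate ;; set_scalar 10 (Const 1)"

lemma wp_build_tables:
  assumes tree: "is_tree {..<n} E"
  shows "wp n build_tables (\<lambda>m. \<exists>par lab. rooted_tree n par \<and> bij_betw lab {..<n} {..<n} \<and>
    E = (`) ((`) lab) (rooted_tree.tree_edges n par) \<and> rooted_tree.tables n par m \<and>
    (\<forall>v<n. m 2 v 0 = lab v) \<and> m 10 0 0 = 1 \<and> rooted_tree.chosen n m = {}) (graph_input n E)"
proof -
  have "wp n order_vertices (wp n (tabulate ;; set_scalar 10 (Const 1)) (\<lambda>m. \<exists>par lab.
    rooted_tree n par \<and> bij_betw lab {..<n} {..<n} \<and>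
    E = (`) ((`) lab) (rooted_tree.tree_edges n par) \<and> rooted_tree.tables n par m \<and>
    (\<forall>v<n. m 2 v 0 = lab v) \<and> m 10 0 0 = 1 \<and> rooted_tree.chosen n m = {})) (graph_input n E)"
  proof (rule wp_mono[OF wp_order_vertices[OF tree]])
    fix m assume inv: "order_inv n E n 0 m"
    let ?par = "\<lambda>i. m 3 i 0" and ?lab = "\<lambda>i. m 2 i 0"
    note result = order_inv_result[OF inv tree]
    interpret rooted_tree n ?par by (rule result(1))
    have same: "same_except {2, 3, 4, 13, 14, 15} (graph_input n E) m"
      using inv by (simp add: order_inv_def)
    have init: "m 0 0 0 = n" "m 5 i j = 0" "m 6 i j = 0" "m 7 i j = 0" "m 8 i j = 0" for i j
      using same_exceptD[OF same] by (simp_all add: graph_input_def)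
    have "wp n tabulate (\<lambda>m'. same_except {5, 6, 7, 14, 15, 16, 17, 18} m m' \<and> tables m') m"
      by (rule wp_tabulate) (simp_all add: init)
    then show "wp n (tabulate ;; set_scalar 10 (Const 1)) (\<lambda>m. \<exists>par lab.
      rooted_tree n par \<and> bij_betw lab {..<n} {..<n} \<and>
      E = (`) ((`) lab) (rooted_tree.tree_edges n par) \<and> rooted_tree.tables n par m \<and>
      (\<forall>v<n. m 2 v 0 = lab v) \<and> m 10 0 0 = 1 \<and> rooted_tree.chosen n m = {}) m"
      unfolding wp.simps(5)
    proof (rule wp_mono)
      fix m'
      assume post: "same_except {5, 6, 7, 14, 15, 16, 17, 18} m m' \<and> tables m'"
      have eqs: "m' 2 = m 2" "m' 8 = m 8"
        using same_exceptD[OF conjunct1[OF post]] by simp_all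
      let ?m = "update m' 10 0 0 1"
      have "tables ?m" using post by (intro tables_update) auto
      moreover have "chosen ?m = {}" using init by (simp add: chosen_def eqs)
      moreover have "\<forall>v<n. ?m 2 v 0 = ?lab v" "?m 10 0 0 = 1" using eqs by simp_all
      ultimately have "rooted_tree n ?par \<and> bij_betw ?lab {..<n} {..<n} \<and>
        E = (`) ((`) ?lab) tree_edges \<and> tables ?m \<and>
        (\<forall>v<n. ?m 2 v 0 = ?lab v) \<and> ?m 10 0 0 = 1 \<and> chosen ?m = {}"
        using result by blast
      then show "wp n (set_scalar 10 (Const 1)) (\<lambda>m. \<exists>par lab.
        rooted_tree n par \<and> bij_betw lab {..<n} {..<n} \<and>
        E = (`) ((`) lab) (rooted_tree.tree_edges n par) \<and> rooted_tree.tables n par m \<and>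
        (\<forall>v<n. m 2 v 0 = lab v) \<and> m 10 0 0 = 1 \<and> rooted_tree.chosen n m = {}) m'"
        unfolding wp.simps aval.simps by blast
    qed
  qed
  then show ?thesis by (simp only: build_tables_def wp.simps(5))
qed

definition enumerate_alliances :: com where
  "enumerate_alliances = build_tables ;; enumerate_loop"

definition delay_bound :: "nat \<Rightarrow> nat" where
  "delay_bound n = cost n build_tables + 2 * round_cost n"

lemma exec_enumerate_alliances:
  assumes tree: "is_tree {..<n} E"
  defines "S \<equiv> {A. globally_minimal_defensive_alliance {..<n} E A}"
  shows "\<exists>tr m'. exec enumerate_alliances (graph_input n E) tr m' \<and> distinct (outputs tr) \<and>
    set (outputs tr) = S \<and> length tr \<le> Suc (n * 2 ^ (n div 2)) * delay_bound n \<and>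
    (\<forall>d\<in>set (delays tr). d \<le> delay_bound n)"
proof -
  obtain tr1 m par lab where prep: "exec build_tables (graph_input n E) tr1 m" "set tr1 \<subseteq> {Tick}"
      "length tr1 \<le> cost n build_tables"
    and rooted: "rooted_tree n par" and lab: "bij_betw lab {..<n} {..<n}"
    and E: "E = (`) ((`) lab) (rooted_tree.tree_edges n par)"
    and m: "rooted_tree.tables n par m" "\<forall>v<n. m 2 v 0 = lab v" "m 10 0 0 = 1"
      "rooted_tree.chosen n m = {}"
    using wp_sound[OF wp_build_tables[OF tree]] by blast
  interpret rooted_tree n par by (rule rooted)
  have inj: "inj_on lab {..<n}" and img: "lab ` {..<n} = {..<n}"
    using lab by (auto simp: bij_betw_def)
  have "tree_edges \<subseteq> Pow {..<n}"
  proof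
    fix e assume "e \<in> tree_edges"
    then obtain i where "e = {i, par i}" "0 < i" "i < n" by (auto simp: tree_edges_def)
    then show "e \<in> Pow {..<n}" using par_less[of i] by simp
  qed
  then have S: "S = (`) lab ` solutions"
    using globally_minimal_set_image[OF inj, of tree_edges] unfolding S_def E solutions_eq img by simp
  have "\<exists>k\<le>n. m 10 0 0 = Suc k \<and> good k (chosen m) \<and> pending k (chosen m) = solutions"
  proof (intro exI conjI)
    show "m 10 0 0 = Suc 0" using m(3) by simp
    show "good 0 (chosen m)" unfolding m(4) by (rule good_0)
    show "pending 0 (chosen m) = solutions" by (rule pending_0)
  qed simp
  note start = exec_enumerate_loop[OF m(1) m(2)[rule_format] inj disjI2[OF this]]
  obtain tr2 m' where loop: "exec enumerate_loop m tr2 m'" "distinct (outputs tr2)"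
      "set (outputs tr2) = (`) lab ` solutions" "hd (delays tr2) \<le> round_cost n"
      "\<forall>d\<in>set (delays tr2). d \<le> 2 * round_cost n"
    using start by blast
  let ?tr = "tr1 @ tr2"
  have run: "exec enumerate_alliances (graph_input n E) ?tr m'"
    unfolding enumerate_alliances_def using prep(1) loop(1) by (rule exec.Seq)
  have out: "outputs ?tr = outputs tr2" by (rule outputs_append_quiet[OF prep(2)])
  have "set (tl (delays tr2)) \<subseteq> set (delays tr2)"
    by (cases "delays tr2") auto
  \<comment> \<open>The preprocessing prolongs only the first block.\<close>
  then have del: "\<forall>d\<in>set (delays ?tr). d \<le> delay_bound n"
    unfolding delays_append_quiet[OF prep(2)] delay_bound_def
    using prep(3) loop(4,5) by (auto simp: subset_iff intro: add_mono trans_le_add2)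
  have "length (outputs tr2) = card S"
    unfolding S loop(3)[symmetric] using loop(2) by (rule distinct_card[symmetric])
  also have "\<dots> \<le> card solutions"
    unfolding S by (rule card_image_le[OF finite_solutions])
  also note card_solutions
  finally have "Suc (length (outputs ?tr)) * delay_bound n \<le> Suc (n * 2 ^ (n div 2)) * delay_bound n"
    unfolding out by (intro mult_right_mono) auto
  then have "length ?tr \<le> Suc (n * 2 ^ (n div 2)) * delay_bound n"
    using length_le_delays[OF del] by (rule order_trans[rotated])
  moreover have "distinct (outputs ?tr)" "set (outputs ?tr) = S"
    unfolding out S by (rule loop)+
  ultimately show ?thesis using run del by blast
qed

lemma delay_bound_poly: "\<exists>D :: nat poly. \<forall>n. delay_bound n = poly D n"
proof -
  obtain p q r s :: "nat poly" where "\<forall>N. cost N build_tables = poly p N"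
    "\<forall>N. cost N complete_prefix = poly q N" "\<forall>N. cost N write_chosen = poly r N"
    "\<forall>N. cost N advance = poly s N"
    using cost_poly by metis
  then show ?thesis
    by (intro exI[of _ "p + 2 * (2 + q + r + s)"])
      (simp add: delay_bound_def round_cost_def)
qed

lemma poly_of_nat: "\<exists>q :: real poly. \<forall>n. poly q (real n) = real (poly p n)"
proof (induction p)
  case 0
  then show ?case by (intro exI[of _ 0]) simp
next
  case (pCons a p)
  then obtain q :: "real poly" where "\<forall>n. poly q (real n) = real (poly p n)" by blast
  then show ?case by (intro exI[of _ "pCons (real a) q"]) simp
qed

lemma power_half_le_sqrt: "2 ^ (n div 2) \<le> sqrt 2 ^ n"
proof -
  have "(2 :: real) ^ (n div 2) = sqrt 2 ^ (2 * (n div 2))"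
    by (simp add: power_mult)
  also have "\<dots> \<le> sqrt 2 ^ n"
    by (intro power_increasing) auto
  finally show ?thesis .
qed

theorem theorem4:
  shows "\<exists>c :: com. \<exists>T \<in> O_star (\<lambda>n. sqrt 2 ^ n). \<exists>D :: nat poly.
    \<forall>(n :: nat) (E :: nat set set). is_tree {..<n} E \<longrightarrow>
      enumerates_within c (graph_input n E)
        {A. globally_minimal_defensive_alliance {..<n} E A} (T n) (poly D n)"
proof -
  obtain D :: "nat poly" where D: "\<forall>n. delay_bound n = poly D n"
    using delay_bound_poly by blast
  obtain q :: "real poly" where q: "\<forall>n. poly q (real n) = real (poly D n)"
    using poly_of_nat by blast
  \<comment> \<open>The factor \<open>[:1, 1:]\<close> is \<open>n + 1\<close>: a run has at most
    \<open>n * 2 ^ (n div 2) + 1\<close> blocks, and \<open>sqrt 2 ^ n\<close> bounds both the power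
    and the extra 1.\<close>
  define p where "p = [:1, 1:] * q"
  define T where "T n = poly p (real n) * sqrt 2 ^ n" for n
  have "T \<in> O_star (\<lambda>n. sqrt 2 ^ n)"
    unfolding O_star_def T_def[abs_def] by (rule UN_I[of p]) simp_all
  moreover have "enumerates_within enumerate_alliances (graph_input n E)
      {A. globally_minimal_defensive_alliance {..<n} E A} (T n) (poly D n)"
    if tree: "is_tree {..<n} E" for n E
  proof -
    have "1 \<le> sqrt 2 ^ n" by (simp add: one_le_power)
    then have "1 + real n * 2 ^ (n div 2) \<le> sqrt 2 ^ n + real n * sqrt 2 ^ n"
      using power_half_le_sqrt[of n] by (intro add_mono mult_left_mono) auto
    then have "(1 + real n * 2 ^ (n div 2)) * real (poly D n)
        \<le> (sqrt 2 ^ n + real n * sqrt 2 ^ n) * real (poly D n)"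
      by (intro mult_right_mono) auto
    then have "real (Suc (n * 2 ^ (n div 2)) * delay_bound n) \<le> T n"
      by (simp add: T_def p_def q D algebra_simps)
    moreover obtain tr m' where run: "exec enumerate_alliances (graph_input n E) tr m'"
        "distinct (outputs tr)"
        "set (outputs tr) = {A. globally_minimal_defensive_alliance {..<n} E A}"
        "length tr \<le> Suc (n * 2 ^ (n div 2)) * delay_bound n"
        "\<forall>d\<in>set (delays tr). d \<le> delay_bound n"
      using exec_enumerate_alliances[OF tree] by blast
    moreover have "real (length tr) \<le> real (Suc (n * 2 ^ (n div 2)) * delay_bound n)"
      using run(4) by (simp only: of_nat_le_iff)
    ultimately have "real (length tr) \<le> T n" by linarith
    then show ?thesis
      using run D unfolding enumerates_within_def by auto
  qed
  ultimately show ?thesis by blast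
qed

end
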